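(* Let $\mathcal{P}\subset\mathbb{R}^3$ be a finite set of points and let $\Sigma$ be a surface with a triangulation $T$ with vertex set $V$. If there is a realization of $(\Sigma,T)$ into $\mathcal{P}$, then the triangulation $T$ can be changed to a triangulation $T_0$ of $\Sigma$, keeping the same vertex set $V$ and the same bijection $V\to\mathcal{P}$, so that the realization of $(\Sigma,T_0)$ into $\mathcal{P}$ is Delaunay. If moreover no $4$ points of $\mathcal{P}$ are coplanar, then there is a strict Delaunay realization.
   Context: A map $f:(\Sigma,T)\to\mathbb{R}^3$ is a realization of $(\Sigma,T)$ into $\mathcal{P}$ if it is linear on each triangle of $T$ and restricts to a bijection from the vertex set $V$ of $T$ to $\mathcal{P}$; it is determined by the bijection $V\to\mathcal{P}$. A realization need not be injective; in particular, different triangles of the triangulation are allowed to have the same image in $\mathbb{R}^3$. Two image triangles $ABD$ and $BCD$ in $\mathbb{R}^3$ that are adjacent along the common edge $BD$ satisfy the Delaunay condition if $\angle BAD+\angle BCD\le\pi$, and the strict Delaunay condition if $\angle BAD+\angle BCD<\pi$. A realization is Delaunay (resp. strict Delaunay) if any two adjacent image triangles satisfy the Delaunay (resp. strict Delaunay) condition. *)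

theory Defs
  imports "HOL-Analysis.Analysis"
begin

text \<open>Surfaces may have boundary and need not be connected; closed surfaces are the special case
  in which every neighbourhood \<open>W\<close> can be chosen inside the open half-plane.\<close>

definition surface :: "'a topology \<Rightarrow> bool" where
  "surface S \<longleftrightarrow> Hausdorff_space S \<and> second_countable S \<and>
     (\<forall>p \<in> topspace S. \<exists>U W. openin S U \<and> p \<in> U \<and>
        openin (top_of_set {z :: real^2. 0 \<le> z $ 2}) W \<and>
        subtopology S U homeomorphic_space top_of_set W)"

text \<open>The model triangle, in barycentric coordinates.  The \<open>real^3\<close> of barycentric coordinates is
  unrelated to the \<open>real^3\<close> in which surfaces are realized.\<close>

definition std_triangle :: "(real^3) set" where
  "std_triangle = {x. (\<forall>i. 0 \<le> x $ i) \<and> (\<Sum>i\<in>UNIV. x $ i) = 1}"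

definition corner :: "3 \<Rightarrow> real^3" where
  "corner i = axis i 1"

definition face :: "3 set \<Rightarrow> (real^3) set" where
  "face I = {x \<in> std_triangle. \<forall>i. i \<notin> I \<longrightarrow> x $ i = 0}"

text \<open>A triangulation \<open>T\<close> is given by one parametrization per triangle.  Triangles have three
  distinct corners and are embedded, but as usual for triangulations that are modified by flips,
  two triangles may share several edges, or have the same corners without being equal.  The last
  clause says that two triangles meet in a (possibly empty) union of common edges and common
  corners, identified with each other by affine maps.  Since \<open>T\<close> is finite, a Hausdorff space \<open>S\<close>
  automatically carries the quotient topology.\<close>

definition surface_triangulation :: "'a topology \<Rightarrow> (real^3 \<Rightarrow> 'a) set \<Rightarrow> 'a set \<Rightarrow> bool" where
  "surface_triangulation S T V \<longleftrightarrow>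
     finite T \<and>
     (\<forall>\<sigma>\<in>T. continuous_map (top_of_set std_triangle) S \<sigma> \<and> inj_on \<sigma> std_triangle) \<and>
     topspace S = (\<Union>\<sigma>\<in>T. \<sigma> ` std_triangle) \<and>
     V = (\<Union>\<sigma>\<in>T. \<sigma> ` range corner) \<and>
     (\<forall>\<sigma>\<in>T. \<forall>\<tau>\<in>T. \<sigma> \<noteq> \<tau> \<longrightarrow>
        (\<forall>p \<in> \<sigma> ` std_triangle \<inter> \<tau> ` std_triangle.
           \<exists>I \<pi>. I \<noteq> UNIV \<and> bij \<pi> \<and> p \<in> \<sigma> ` face I \<and>
             (\<forall>x \<in> face I. \<sigma> x = \<tau> (\<chi> i. x $ \<pi> i))))"

definition realization ::
  "'a topology \<Rightarrow> (real^3 \<Rightarrow> 'a) set \<Rightarrow> 'a set \<Rightarrow> (real^3) set \<Rightarrow> ('a \<Rightarrow> real^3) \<Rightarrow> bool" where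
  "realization S T V P f \<longleftrightarrow>
     continuous_map S euclidean f \<and>
     (\<forall>\<sigma>\<in>T. \<forall>x\<in>std_triangle. f (\<sigma> x) = (\<Sum>i\<in>UNIV. x $ i *\<^sub>R f (\<sigma> (corner i)))) \<and>
     bij_betw f V P"

text \<open>The angle \<open>BAD\<close> at \<open>A\<close>, for \<open>B\<close> and \<open>D\<close> different from \<open>A\<close>; it is 0 or \<open>pi\<close> if the three
  points are collinear.\<close>

definition angle_at :: "real^3 \<Rightarrow> real^3 \<Rightarrow> real^3 \<Rightarrow> real" where
  "angle_at B A D = arccos (((B - A) \<bullet> (D - A)) / (norm (B - A) * norm (D - A)))"

definition delaunay_condition :: "real^3 \<Rightarrow> real^3 \<Rightarrow> real^3 \<Rightarrow> real^3 \<Rightarrow> bool" where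
  "delaunay_condition A B C D \<longleftrightarrow> angle_at B A D + angle_at B C D \<le> pi"

definition strict_delaunay_condition :: "real^3 \<Rightarrow> real^3 \<Rightarrow> real^3 \<Rightarrow> real^3 \<Rightarrow> bool" where
  "strict_delaunay_condition A B C D \<longleftrightarrow> angle_at B A D + angle_at B C D < pi"

text \<open>\<open>adjacent_images T f A B C D\<close>: \<open>ABD\<close> and \<open>BCD\<close> are two image triangles that are adjacent along
  the image \<open>BD\<close> of an edge of \<open>T\<close>.  The edge of \<open>\<sigma>\<close> opposite to \<open>corner i\<close> is glued to the edge of
  \<open>\<tau>\<close> opposite to \<open>corner j\<close>.  The requirement \<open>A \<noteq> C\<close> says that there really are two image
  triangles: if \<open>A = C\<close>, then \<open>\<sigma>\<close> and \<open>\<tau>\<close> have the same image.\<close>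

definition adjacent_images ::
  "(real^3 \<Rightarrow> 'a) set \<Rightarrow> ('a \<Rightarrow> real^3) \<Rightarrow> real^3 \<Rightarrow> real^3 \<Rightarrow> real^3 \<Rightarrow> real^3 \<Rightarrow> bool" where
  "adjacent_images T f A B C D \<longleftrightarrow>
     (\<exists>\<sigma>\<in>T. \<exists>\<tau>\<in>T. \<exists>i j k l.
        \<sigma> \<noteq> \<tau> \<and> {i, k, l} = UNIV \<and> \<sigma> ` face (- {i}) = \<tau> ` face (- {j}) \<and>
        A = f (\<sigma> (corner i)) \<and> C = f (\<tau> (corner j)) \<and> A \<noteq> C \<and>
        B = f (\<sigma> (corner k)) \<and> D = f (\<sigma> (corner l)))"

definition delaunay :: "(real^3 \<Rightarrow> 'a) set \<Rightarrow> ('a \<Rightarrow> real^3) \<Rightarrow> bool" where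
  "delaunay T f \<longleftrightarrow> (\<forall>A B C D. adjacent_images T f A B C D \<longrightarrow> delaunay_condition A B C D)"

definition strict_delaunay :: "(real^3 \<Rightarrow> 'a) set \<Rightarrow> ('a \<Rightarrow> real^3) \<Rightarrow> bool" where
  "strict_delaunay T f \<longleftrightarrow>
     (\<forall>A B C D. adjacent_images T f A B C D \<longrightarrow> strict_delaunay_condition A B C D)"

end

theory Submission
  imports Defs
begin

text \<open>Consider all triangulations of \<open>S\<close> with vertex set \<open>V\<close> and with as many triangles as \<open>T\<close>.  The
total area of the image triangles takes only finitely many values on them, since it depends only on
how often each subset of \<open>P\<close> occurs as the set of corners of an image triangle.  A triangulation
with the smallest area (for a suitable perturbed notion of area) is Delaunay: if two adjacent image
triangles \<open>ABD\<close> and \<open>BCD\<close> violate the condition, then exchanging the edge \<open>BD\<close> for the other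
diagonal \<open>AC\<close> would decrease the total area.

Area decreases for the following reason.  Let \<open>a\<close>, \<open>b\<close>, \<open>c\<close>, \<open>d\<close> be the lengths of the sides
\<open>AB\<close>, \<open>BC\<close>, \<open>CD\<close>, \<open>DA\<close> of a spatial quadrilateral and \<open>\<alpha>\<close>, \<open>\<beta>\<close>, \<open>\<gamma>\<close>, \<open>\<delta>\<close> its angles at \<open>A\<close>, \<open>B\<close>,
\<open>C\<close>, \<open>D\<close>.  The two ways to span it by a pair of triangles satisfy Bretschneider's identity
\<open>(area ABD + area BCD)\<^sup>2 - (area ABC + area ACD)\<^sup>2 = a b c d (cos (\<beta> + \<delta>) - cos (\<alpha> + \<gamma>)) / 2\<close>
(\<open>flip_area_identity\<close>).  The triangle inequality for angles, applied at \<open>B\<close> and \<open>D\<close>, gives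
\<open>\<alpha> + \<beta> + \<gamma> + \<delta> < 2 \<pi>\<close> unless the four points are coplanar.  So \<open>\<alpha> + \<gamma> \<ge> \<pi>\<close> implies
\<open>\<beta> + \<delta> < 2 \<pi> - (\<alpha> + \<gamma>) \<le> \<pi>\<close>, and the area drops (\<open>flip_decreases_area\<close>).  This settles the strict
version, where no four points of \<open>P\<close> are coplanar.

For coplanar points a flip may preserve the area.  But the area inequality holds in every inner
product space.  Add to each point of \<open>P\<close> a short vector, of the same length for all points, in a new
direction of its own.  Then no four points are coplanar, and all squared
distances between distinct points grow by the same constant \<open>\<epsilon>\<close>.  The violated condition
\<open>\<alpha> + \<gamma> > \<pi>\<close> is open, so it survives for small \<open>\<epsilon>\<close>, uniformly over the finitely many quadruples in
\<open>P\<close> (\<open>uniform_perturbation\<close>).  Hence every flip at a violating edge decreases the perturbed area.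

The flip itself is possible in the surface.  If \<open>A \<noteq> C\<close>, the two triangles in the surface have four
different vertices, so that they meet in the common edge only and form an embedded quadrilateral,
which can be cut along its other diagonal.  The new triangles fit with the remaining ones provided
that no third triangle contains the old edge.  This is where \<open>S\<close> being a surface enters: by invariance of domain,
an inner point of the edge has a neighbourhood in the quadrilateral that is open in \<open>S\<close>, so a third
triangle through this point would have interior points inside the first two
(\<open>hinge_edge_in_no_third_triangle\<close>).  Finally, a piecewise linear map is determined by the images of
the vertices, so that the new triangulation has a realization with the same vertex map
(\<open>realization_extends_vertex_map\<close>).\<close>

section \<open>Angles and triangles in inner product spaces\<close>

definition vec_angle :: "'b::real_inner \<Rightarrow> 'b \<Rightarrow> real" where
  "vec_angle x y = arccos (x \<bullet> y / (norm x * norm y))"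

lemma abs_cos_quotient_le_1: "\<bar>x \<bullet> y / (norm x * norm y)\<bar> \<le> 1" for x y :: "'b::real_inner"
proof (cases "x = 0 \<or> y = 0")
  case False
  then show ?thesis
    using Cauchy_Schwarz_ineq2[of x y] by (simp add: divide_le_eq abs_mult)
qed auto

lemma vec_angle_bounds: "0 \<le> vec_angle x y" "vec_angle x y \<le> pi"
  unfolding vec_angle_def using abs_cos_quotient_le_1[of x y]
  by (auto simp only: abs_le_iff minus_le_iff intro: arccos_lbound arccos_ubound)

lemma cos_vec_angle: "cos (vec_angle x y) = x \<bullet> y / (norm x * norm y)"
  unfolding vec_angle_def using abs_cos_quotient_le_1[of x y]
  by (auto simp only: abs_le_iff minus_le_iff intro: cos_arccos)

lemma inner_eq_cos: "x \<bullet> y = norm x * norm y * cos (vec_angle x y)"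
  by (cases "x = 0 \<or> y = 0") (auto simp: cos_vec_angle)

lemma sin_vec_angle_nonneg: "0 \<le> sin (vec_angle x y)"
  using vec_angle_bounds by (intro sin_ge_zero)

lemma vec_angle_commute: "vec_angle x y = vec_angle y x"
  by (simp add: vec_angle_def inner_commute mult.commute)

text \<open>For unit vectors, \<open>cos (s + t)\<close> is a lower bound for the inner product of \<open>x\<close> and \<open>z\<close> if these have the
angles \<open>s\<close> and \<open>t\<close> with \<open>y\<close>: this is the Cauchy-Schwarz inequality for their components \<open>u\<close>
and \<open>w\<close> orthogonal to \<open>y\<close>, whose norms are \<open>sin s\<close> and \<open>sin t\<close>.  Equality forces \<open>u\<close> and \<open>w\<close> to be
parallel, and then \<open>x\<close>, \<open>y\<close>, \<open>z\<close> are dependent.\<close>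

lemma cos_add_le_cos_vec_angle:
  fixes x y z :: "'b::real_inner"
  assumes nz: "x \<noteq> 0" "y \<noteq> 0" "z \<noteq> 0"
  shows "cos (vec_angle x y + vec_angle y z) \<le> cos (vec_angle x z)"
    and "cos (vec_angle x y + vec_angle y z) = cos (vec_angle x z) \<Longrightarrow>
      \<exists>p q r. p *\<^sub>R x + q *\<^sub>R y + r *\<^sub>R z = 0 \<and> (p \<noteq> 0 \<or> q \<noteq> 0 \<or> r \<noteq> 0)"
proof -
  define s t where "s = vec_angle x y" and "t = vec_angle y z"
  define x' y' z' where "x' = sgn x" and "y' = sgn y" and "z' = sgn z"
  have unit: "x' \<bullet> x' = 1" "y' \<bullet> y' = 1" "z' \<bullet> z' = 1"
    using nz by (simp_all add: x'_def y'_def z'_def dot_square_norm norm_sgn)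
  have cs: "x' \<bullet> y' = cos s" and ct: "y' \<bullet> z' = cos t" and cxz: "x' \<bullet> z' = cos (vec_angle x z)"
    using nz by (simp_all add: cos_vec_angle s_def t_def x'_def y'_def z'_def sgn_div_norm field_simps)
  define u w where "u = x' - cos s *\<^sub>R y'" and "w = z' - cos t *\<^sub>R y'"
  have "u \<bullet> u = (sin s)\<^sup>2"
    using unit cs by (simp add: u_def inner_diff inner_commute sin_squared_eq power2_eq_square algebra_simps)
  then have nu: "norm u = sin s"
    using sin_vec_angle_nonneg[of x y] by (simp add: norm_eq_sqrt_inner s_def)
  have "w \<bullet> w = (sin t)\<^sup>2"
    using unit ct by (simp add: w_def inner_diff inner_commute sin_squared_eq power2_eq_square algebra_simps)
  then have nw: "norm w = sin t"
    using sin_vec_angle_nonneg[of y z] by (simp add: norm_eq_sqrt_inner t_def)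
  have uw: "u \<bullet> w = cos (vec_angle x z) - cos s * cos t"
    using unit cs ct cxz by (simp add: u_def w_def inner_diff inner_commute algebra_simps)
  have "- (u \<bullet> w) \<le> norm u * norm w"
    using norm_cauchy_schwarz[of "- u" w] by simp
  then show "cos (vec_angle x y + vec_angle y z) \<le> cos (vec_angle x z)"
    by (simp add: uw nu nw cos_add flip: s_def t_def)
  assume "cos (vec_angle x y + vec_angle y z) = cos (vec_angle x z)"
  then have "- (u \<bullet> w) = norm u * norm w"
    by (simp add: uw nu nw cos_add flip: s_def t_def)
  then have "u \<bullet> (- w) = norm u * norm (- w)"
    by simp
  then have "norm u *\<^sub>R (- w) = norm (- w) *\<^sub>R u"
    by (simp only: norm_cauchy_schwarz_eq)
  then have "norm w *\<^sub>R u + norm u *\<^sub>R w = 0"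
    by (metis add.commute add.right_inverse norm_minus_cancel scaleR_minus_right)
  then have dep: "(norm w / norm x) *\<^sub>R x + (- (norm w * cos s + norm u * cos t) / norm y) *\<^sub>R y
      + (norm u / norm z) *\<^sub>R z = 0"
    by (simp add: u_def w_def x'_def y'_def z'_def sgn_div_norm algebra_simps
        add_divide_distrib diff_divide_distrib divide_inverse_commute)
  show "\<exists>p q r. p *\<^sub>R x + q *\<^sub>R y + r *\<^sub>R z = 0 \<and> (p \<noteq> 0 \<or> q \<noteq> 0 \<or> r \<noteq> 0)"
  proof (cases "u = 0")
    case True
    then have "(1 / norm x) *\<^sub>R x + (- cos s / norm y) *\<^sub>R y + 0 *\<^sub>R z = 0"
      by (simp add: u_def x'_def y'_def sgn_div_norm divide_inverse_commute)
    then show ?thesis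
      using nz by (metis divide_eq_0_iff norm_eq_zero zero_neq_one)
  next
    case False
    then show ?thesis
      using dep nz by (metis divide_eq_0_iff norm_eq_zero)
  qed
qed

lemma vec_angle_triangle:
  fixes x y z :: "'b::real_inner"
  assumes nz: "x \<noteq> 0" "y \<noteq> 0" "z \<noteq> 0"
  shows "vec_angle x z \<le> vec_angle x y + vec_angle y z"
    and "(\<And>p q r. p *\<^sub>R x + q *\<^sub>R y + r *\<^sub>R z = 0 \<Longrightarrow> p = 0 \<and> q = 0 \<and> r = 0) \<Longrightarrow>
      vec_angle x z < vec_angle x y + vec_angle y z"
proof -
  let ?s = "vec_angle x y + vec_angle y z"
  have b: "0 \<le> ?s" "0 \<le> vec_angle x z" "vec_angle x z \<le> pi"
    using vec_angle_bounds[of x y] vec_angle_bounds[of y z] vec_angle_bounds[of x z] by auto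
  show le: "vec_angle x z \<le> ?s"
  proof (rule ccontr)
    assume "\<not> vec_angle x z \<le> ?s"
    then show False
      using cos_monotone_0_pi[of ?s "vec_angle x z"] b cos_add_le_cos_vec_angle(1)[OF nz] by linarith
  qed
  assume "\<And>p q r. p *\<^sub>R x + q *\<^sub>R y + r *\<^sub>R z = 0 \<Longrightarrow> p = 0 \<and> q = 0 \<and> r = 0"
  then have "cos ?s \<noteq> cos (vec_angle x z)"
    using cos_add_le_cos_vec_angle(2)[OF nz] by blast
  then have "vec_angle x z \<noteq> ?s"
    by metis
  then show "vec_angle x z < ?s"
    using le by linarith
qed

text \<open>With \<open>A\<close>, \<open>B\<close>, \<open>C\<close> for the three angles, the cosine and the sine of \<open>A + C\<close> can be computed from inner
products.  The cosine is that of \<open>pi - B\<close>.  The sine is nonnegative and \<open>A = C = pi\<close> is impossible, so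
\<open>A + C\<close> lies in the interval from \<open>0\<close> to \<open>pi\<close>, where the cosine is injective.\<close>

lemma triangle_angle_sum:
  fixes u v :: "'b::real_inner"
  assumes "u \<noteq> 0" "v \<noteq> 0" "u \<noteq> v"
  shows "vec_angle u v + vec_angle (- u) (v - u) + vec_angle (- v) (u - v) = pi"
proof -
  define A B C where "A = vec_angle u v" and "B = vec_angle (- u) (v - u)" and "C = vec_angle (- v) (u - v)"
  define p q r where "p = norm u" and "q = norm v" and "r = norm (u - v)"
  have pos: "p > 0" "q > 0" "r > 0"
    using assms by (auto simp: p_def q_def r_def)
  have u2: "u \<bullet> u = p\<^sup>2" and v2: "v \<bullet> v = q\<^sup>2"
    by (simp_all add: p_def q_def dot_square_norm)
  have cA: "p * q * cos A = u \<bullet> v"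
    by (simp add: A_def p_def q_def inner_eq_cos)
  have cB: "p * r * cos B = p\<^sup>2 - u \<bullet> v"
    using inner_eq_cos[of "- u" "v - u"] u2
    by (simp add: B_def p_def r_def norm_minus_commute inner_diff)
  have cC: "q * r * cos C = q\<^sup>2 - u \<bullet> v"
    using inner_eq_cos[of "- v" "u - v"] v2
    by (simp add: C_def q_def r_def inner_diff inner_commute)
  have r2: "r\<^sup>2 = p\<^sup>2 + q\<^sup>2 - 2 * (u \<bullet> v)"
    using u2 v2 by (simp add: r_def power2_norm_eq_inner inner_diff inner_commute)
  have nonneg: "sin A \<ge> 0" "sin C \<ge> 0" "sin B \<ge> 0"
    by (simp_all add: A_def B_def C_def sin_vec_angle_nonneg)
  have sA2: "(p * q * sin A)\<^sup>2 = p\<^sup>2 * q\<^sup>2 - (u \<bullet> v)\<^sup>2"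
    by (simp add: cA[symmetric] power_mult_distrib sin_squared_eq algebra_simps)
  have "(q * r * sin C)\<^sup>2 = q\<^sup>2 * r\<^sup>2 - (q\<^sup>2 - u \<bullet> v)\<^sup>2"
    by (simp add: cC[symmetric] power_mult_distrib sin_squared_eq algebra_simps)
  also have "\<dots> = (p * q * sin A)\<^sup>2"
    unfolding sA2 r2 by (simp add: power2_eq_square algebra_simps)
  finally have sC: "q * r * sin C = p * q * sin A"
    using pos nonneg by (simp add: power2_eq_iff_nonneg)
  have "(p * q * r * q) * cos (A + C) = (p * q * cos A) * (q * r * cos C) - (p * q * sin A) * (q * r * sin C)"
    by (simp add: cos_add algebra_simps)
  also have "\<dots> = (u \<bullet> v) * (q\<^sup>2 - u \<bullet> v) - (p * q * sin A)\<^sup>2"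
    unfolding cA cC sC by (simp add: power2_eq_square)
  also have "\<dots> = - q\<^sup>2 * (p * r * cos B)"
    unfolding sA2 cB by (simp add: power2_eq_square algebra_simps)
  finally have "(p * q * r * q) * cos (A + C) = (p * q * r * q) * - cos B"
    by (simp add: power2_eq_square algebra_simps)
  then have "cos (A + C) = - cos B"
    using pos by (metis less_irrefl mult_cancel_left mult_pos_pos)
  then have cos_eq: "cos (A + C) = cos (pi - B)"
    by simp
  have "(p * q * r * q) * sin (A + C) = (p * q * sin A) * (q * r * cos C) + (p * q * cos A) * (q * r * sin C)"
    by (simp add: sin_add algebra_simps)
  also have "\<dots> = (p * q * sin A) * q\<^sup>2"
    unfolding cA cC sC by (simp add: algebra_simps)
  finally have "(p * q * r * q) * sin (A + C) = (p * q * sin A) * q\<^sup>2" .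
  moreover have "(p * q * sin A) * q\<^sup>2 \<ge> 0"
    using pos nonneg by simp
  ultimately have "(p * q * r * q) * sin (A + C) \<ge> 0"
    by linarith
  then have sin_nonneg: "sin (A + C) \<ge> 0"
    using zero_le_mult_iff[of "p * q * r * q" "sin (A + C)"] mult_pos_pos[OF mult_pos_pos[OF mult_pos_pos]] pos
    by (meson less_le_not_le)
  have bounds: "0 \<le> A" "A \<le> pi" "0 \<le> B" "B \<le> pi" "0 \<le> C" "C \<le> pi"
    by (simp_all add: A_def B_def C_def vec_angle_bounds)
  have "A + C \<le> pi"
  proof (rule ccontr)
    assume "\<not> A + C \<le> pi"
      \<comment> \<open>the sine is negative strictly between pi and 2 * pi\<close>
    then have "A + C = 2 * pi"
      using sin_lt_zero[of "A + C"] bounds sin_nonneg by linarith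
    then have "A = pi" "C = pi"
      using bounds by linarith+
    then have "cos A = -1" "cos C = -1"
      by simp_all
    then have "u \<bullet> v < 0" "q\<^sup>2 - u \<bullet> v < 0"
      using cA cC pos by (metis mult_minus1_right mult_pos_pos neg_less_0_iff_less)+
    then show False
      by (smt (verit) zero_le_power2)
  qed
  then have "A + C = pi - B"
    using cos_eq bounds cos_inj_pi[of "A + C" "pi - B"] by simp
  then show ?thesis
    by (simp add: A_def B_def C_def)
qed

section \<open>The area inequality for flips in a spatial quadrilateral\<close>

text \<open>Heron's formula: the value is 16 times the square of the area of a triangle whose sides have the
squared lengths \<open>p\<close>, \<open>q\<close>, \<open>r\<close>.\<close>

definition heron :: "real \<Rightarrow> real \<Rightarrow> real \<Rightarrow> real" where
  "heron p q r = (p + q + r)\<^sup>2 - 2 * (p\<^sup>2 + q\<^sup>2 + r\<^sup>2)"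

lemma heron_eq_two_sides_and_angle:
  fixes u v :: "'b::real_inner"
  shows "heron ((norm u)\<^sup>2) ((norm v)\<^sup>2) ((norm (u - v))\<^sup>2) = (2 * norm u * norm v * sin (vec_angle u v))\<^sup>2"
proof -
  have "(norm (u - v))\<^sup>2 = (norm u)\<^sup>2 + (norm v)\<^sup>2 - 2 * (norm u * norm v * cos (vec_angle u v))"
    by (simp add: power2_norm_eq_inner inner_diff inner_commute flip: inner_eq_cos)
  then show ?thesis
    by (simp only: heron_def power_mult_distrib sin_squared_eq) (simp add: power2_eq_square algebra_simps)
qed

text \<open>Bretschneider's formula for the sum of the areas of two triangles that span a quadrilateral, written
for both diagonals and subtracted.  Only the quantities \<open>x\<close> and \<open>y\<close>, which the law of cosines expresses
by the sides, contain cosines of single angles.\<close>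

lemma flip_area_identity:
  fixes a b c d :: real
  assumes e: "a\<^sup>2 + b\<^sup>2 - 2 * a * b * cos \<beta> = c\<^sup>2 + d\<^sup>2 - 2 * c * d * cos \<delta>"
    and f: "a\<^sup>2 + d\<^sup>2 - 2 * a * d * cos \<alpha> = b\<^sup>2 + c\<^sup>2 - 2 * b * c * cos \<gamma>"
  shows "(a * d * sin \<alpha> + b * c * sin \<gamma>)\<^sup>2 - (a * b * sin \<beta> + c * d * sin \<delta>)\<^sup>2
    = 2 * (a * b * c * d) * (cos (\<beta> + \<delta>) - cos (\<alpha> + \<gamma>))"
proof -
  define x y where "x = a * d * cos \<alpha> - b * c * cos \<gamma>" and "y = a * b * cos \<beta> - c * d * cos \<delta>"
  have x: "x = (a\<^sup>2 + d\<^sup>2 - b\<^sup>2 - c\<^sup>2) / 2" and y: "y = (a\<^sup>2 + b\<^sup>2 - c\<^sup>2 - d\<^sup>2) / 2"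
    using e f by (simp_all add: x_def y_def)
  have sq: "(sin t)\<^sup>2 = 1 - (cos t)\<^sup>2" for t :: real
    by (simp add: sin_squared_eq)
  have "(a * d * sin \<alpha> + b * c * sin \<gamma>)\<^sup>2 - (a * b * sin \<beta> + c * d * sin \<delta>)\<^sup>2
      = a\<^sup>2 * d\<^sup>2 * (sin \<alpha>)\<^sup>2 + b\<^sup>2 * c\<^sup>2 * (sin \<gamma>)\<^sup>2 - a\<^sup>2 * b\<^sup>2 * (sin \<beta>)\<^sup>2 - c\<^sup>2 * d\<^sup>2 * (sin \<delta>)\<^sup>2
        + 2 * (a * b * c * d) * (sin \<alpha> * sin \<gamma> - sin \<beta> * sin \<delta>)"
    by (simp add: power2_eq_square algebra_simps)
  also have "\<dots> = (a\<^sup>2 * d\<^sup>2 + b\<^sup>2 * c\<^sup>2 - x\<^sup>2) - (a\<^sup>2 * b\<^sup>2 + c\<^sup>2 * d\<^sup>2 - y\<^sup>2)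
      + 2 * (a * b * c * d) * (cos (\<beta> + \<delta>) - cos (\<alpha> + \<gamma>))"
    unfolding sq x_def y_def cos_add by (simp add: power2_eq_square algebra_simps)
  also have "(a\<^sup>2 * d\<^sup>2 + b\<^sup>2 * c\<^sup>2 - x\<^sup>2) - (a\<^sup>2 * b\<^sup>2 + c\<^sup>2 * d\<^sup>2 - y\<^sup>2) = 0"
    unfolding x y by (simp add: power2_eq_square field_simps)
  finally show ?thesis
    by simp
qed

text \<open>The angle sum of a spatial quadrilateral is at most that of the two triangles into which \<open>BD\<close>
cuts it, and it is smaller if the vectors from \<open>B\<close> to \<open>A\<close>, \<open>C\<close>, \<open>D\<close> are independent.  With
\<open>flip_area_identity\<close>, the monotonicity of the cosine on \<open>[0, pi]\<close> gives the claim.\<close>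

lemma flip_decreases_area:
  fixes A B C D :: "'b::real_inner"
  assumes dist: "A \<noteq> B" "B \<noteq> C" "C \<noteq> D" "D \<noteq> A" "A \<noteq> C" "B \<noteq> D"
    and obtuse: "vec_angle (B - A) (D - A) + vec_angle (B - C) (D - C) \<ge> pi"
    and indep: "\<And>p q r. p *\<^sub>R (A - B) + q *\<^sub>R (D - B) + r *\<^sub>R (C - B) = 0 \<Longrightarrow> p = 0 \<and> q = 0 \<and> r = 0"
  shows "sqrt (heron ((norm (A - B))\<^sup>2) ((norm (B - C))\<^sup>2) ((norm (A - C))\<^sup>2))
      + sqrt (heron ((norm (C - D))\<^sup>2) ((norm (D - A))\<^sup>2) ((norm (A - C))\<^sup>2))
    < sqrt (heron ((norm (A - B))\<^sup>2) ((norm (D - A))\<^sup>2) ((norm (B - D))\<^sup>2))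
      + sqrt (heron ((norm (B - C))\<^sup>2) ((norm (C - D))\<^sup>2) ((norm (B - D))\<^sup>2))"
proof -
  define a b c d where "a = norm (A - B)" and "b = norm (B - C)" and "c = norm (C - D)" and "d = norm (D - A)"
  define \<alpha> \<beta> \<gamma> \<delta> where "\<alpha> = vec_angle (B - A) (D - A)" and "\<beta> = vec_angle (A - B) (C - B)"
    and "\<gamma> = vec_angle (B - C) (D - C)" and "\<delta> = vec_angle (A - D) (C - D)"
  note angles = \<alpha>_def \<beta>_def \<gamma>_def \<delta>_def
  have sides: "norm (A - B) = a" "norm (B - A) = a" "norm (B - C) = b" "norm (C - B) = b"
    "norm (C - D) = c" "norm (D - C) = c" "norm (D - A) = d" "norm (A - D) = d"
    by (simp_all add: a_def b_def c_def d_def norm_minus_commute)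
  have pos: "a > 0" "b > 0" "c > 0" "d > 0"
    using dist by (auto simp: a_def b_def c_def d_def)
  have "\<beta> < vec_angle (A - B) (D - B) + vec_angle (D - B) (C - B)"
    unfolding angles using dist indep by (intro vec_angle_triangle(2)) auto
  moreover have "\<delta> \<le> vec_angle (A - D) (B - D) + vec_angle (B - D) (C - D)"
    unfolding angles using dist by (intro vec_angle_triangle(1)) auto
  moreover have "\<alpha> + vec_angle (A - B) (D - B) + vec_angle (A - D) (B - D) = pi"
    using triangle_angle_sum[of "B - A" "D - A"] dist by (simp add: angles)
  moreover have "\<gamma> + vec_angle (D - B) (C - B) + vec_angle (B - D) (C - D) = pi"
    using triangle_angle_sum[of "B - C" "D - C"] dist
    by (simp add: angles vec_angle_commute)
  ultimately have sum: "\<alpha> + \<beta> + \<gamma> + \<delta> < 2 * pi"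
    by linarith
  have bounds: "0 \<le> \<beta>" "0 \<le> \<delta>"
    by (simp_all add: angles vec_angle_bounds)
  \<comment> \<open>both arguments lie between 0 and pi, as the angles at A and C add up to pi at least\<close>
  have "cos (2 * pi - (\<alpha> + \<gamma>)) < cos (\<beta> + \<delta>)"
    using sum obtuse bounds by (intro cos_monotone_0_pi) (auto simp: angles)
  then have cos_less: "cos (\<alpha> + \<gamma>) < cos (\<beta> + \<delta>)"
    by (simp add: cos_diff)
  have sines: "sin \<alpha> \<ge> 0" "sin \<beta> \<ge> 0" "sin \<gamma> \<ge> 0" "sin \<delta> \<ge> 0"
    by (simp_all add: angles sin_vec_angle_nonneg)
  have law: "(norm (x - y))\<^sup>2 = (norm x)\<^sup>2 + (norm y)\<^sup>2 - 2 * norm x * norm y * cos (vec_angle x y)"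
    for x y :: 'b
    using inner_eq_cos[of x y] by (simp add: power2_norm_eq_inner inner_diff inner_commute)
  have "(a * d * sin \<alpha> + b * c * sin \<gamma>)\<^sup>2 - (a * b * sin \<beta> + c * d * sin \<delta>)\<^sup>2
    = 2 * (a * b * c * d) * (cos (\<beta> + \<delta>) - cos (\<alpha> + \<gamma>))"
  proof (rule flip_area_identity)
    show "a\<^sup>2 + b\<^sup>2 - 2 * a * b * cos \<beta> = c\<^sup>2 + d\<^sup>2 - 2 * c * d * cos \<delta>"
      using law[of "A - B" "C - B"] law[of "A - D" "C - D"] sides
      by (simp add: \<beta>_def \<delta>_def)
    show "a\<^sup>2 + d\<^sup>2 - 2 * a * d * cos \<alpha> = b\<^sup>2 + c\<^sup>2 - 2 * b * c * cos \<gamma>"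
      using law[of "B - A" "D - A"] law[of "B - C" "D - C"] sides
      by (simp add: \<alpha>_def \<gamma>_def)
  qed
  then have "(a * b * sin \<beta> + c * d * sin \<delta>)\<^sup>2 < (a * d * sin \<alpha> + b * c * sin \<gamma>)\<^sup>2"
    using cos_less pos by (smt (verit) mult_pos_pos)
  then have less: "a * b * sin \<beta> + c * d * sin \<delta> < a * d * sin \<alpha> + b * c * sin \<gamma>"
    using pos sines by (intro power2_less_imp_less[of "a * b * sin \<beta> + c * d * sin \<delta>"]) simp_all
  have area: "sqrt (heron ((norm u)\<^sup>2) ((norm v)\<^sup>2) ((norm (u - v))\<^sup>2))
      = 2 * (norm u * norm v * sin (vec_angle u v))"
    for u v :: 'b
    unfolding heron_eq_two_sides_and_angle real_sqrt_abs using sin_vec_angle_nonneg[of u v] by simp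
  show ?thesis
    using less area[of "A - B" "C - B"] area[of "C - D" "A - D"] area[of "B - A" "D - A"] area[of "B - C" "D - C"]
    by (simp add: angles sides norm_minus_commute[of C A] vec_angle_commute[of "C - D"])
qed

section \<open>Perturbed areas\<close>

text \<open>The squared distance after each point has been moved by a vector of squared length \<open>\<epsilon> / 2\<close> in a
direction of its own, orthogonal to the space and to the directions of all other points.\<close>

definition perturbed_sqdist :: "real \<Rightarrow> real^3 \<Rightarrow> real^3 \<Rightarrow> real" where
  "perturbed_sqdist \<epsilon> X Y = (if X = Y then 0 else (norm (X - Y))\<^sup>2 + \<epsilon>)"

text \<open>Four times the area of the perturbed triangle.  Heron's formula in terms of sums over all ordered pairs
of corners makes sense for every set of points and shows that the order of the corners is irrelevant.\<close>

definition perturbed_area :: "real \<Rightarrow> (real^3) set \<Rightarrow> real" where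
  "perturbed_area \<epsilon> Z = sqrt ((\<Sum>X\<in>Z. \<Sum>Y\<in>Z. perturbed_sqdist \<epsilon> X Y)\<^sup>2 / 4
    - (\<Sum>X\<in>Z. \<Sum>Y\<in>Z. (perturbed_sqdist \<epsilon> X Y)\<^sup>2))"

lemma perturbed_area_heron:
  assumes "X \<noteq> Y" "Y \<noteq> Z" "X \<noteq> Z"
  shows "perturbed_area \<epsilon> {X, Y, Z}
    = sqrt (heron ((norm (X - Y))\<^sup>2 + \<epsilon>) ((norm (Y - Z))\<^sup>2 + \<epsilon>) ((norm (X - Z))\<^sup>2 + \<epsilon>))"
proof -
  define p q r where "p = (norm (X - Y))\<^sup>2 + \<epsilon>" and "q = (norm (Y - Z))\<^sup>2 + \<epsilon>"
    and "r = (norm (X - Z))\<^sup>2 + \<epsilon>"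
  have l: "perturbed_sqdist \<epsilon> X X = 0" "perturbed_sqdist \<epsilon> Y Y = 0" "perturbed_sqdist \<epsilon> Z Z = 0"
    "perturbed_sqdist \<epsilon> X Y = p" "perturbed_sqdist \<epsilon> Y X = p"
    "perturbed_sqdist \<epsilon> Y Z = q" "perturbed_sqdist \<epsilon> Z Y = q"
    "perturbed_sqdist \<epsilon> X Z = r" "perturbed_sqdist \<epsilon> Z X = r"
    using assms by (auto simp: perturbed_sqdist_def p_def q_def r_def norm_minus_commute)
  have "(\<Sum>A\<in>{X, Y, Z}. \<Sum>B\<in>{X, Y, Z}. perturbed_sqdist \<epsilon> A B) = 2 * (p + q + r)"
    and "(\<Sum>A\<in>{X, Y, Z}. \<Sum>B\<in>{X, Y, Z}. (perturbed_sqdist \<epsilon> A B)\<^sup>2) = 2 * (p\<^sup>2 + q\<^sup>2 + r\<^sup>2)"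
    using assms by (simp_all add: l)
  then show ?thesis
    unfolding perturbed_area_def heron_def p_def[symmetric] q_def[symmetric] r_def[symmetric]
    by (simp only: power_mult_distrib) simp
qed

lemma angle_at_eq: "angle_at B A D = vec_angle (B - A) (D - A)"
  by (simp add: angle_at_def vec_angle_def)

lemma vec_angle_sum_gt_pi_iff:
  fixes u v :: "'b::real_inner" and x y :: "'c::real_inner"
  shows "vec_angle u v + vec_angle x y > pi
    \<longleftrightarrow> u \<bullet> v / (norm u * norm v) + x \<bullet> y / (norm x * norm y) < 0"
proof -
  have "pi - vec_angle x y < vec_angle u v \<longleftrightarrow> cos (vec_angle u v) < cos (pi - vec_angle x y)"
    using cos_mono_less_eq[of "vec_angle u v" "pi - vec_angle x y"] vec_angle_bounds[of u v] vec_angle_bounds[of x y]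
    by simp
  then show ?thesis
    by (auto simp: cos_vec_angle)
qed

text \<open>The points \<open>A'\<close>, \<open>B'\<close>, \<open>C'\<close>, \<open>D'\<close> of an arbitrary inner product space serve as a model of the perturbed
quadruple.  No model of all of \<open>P\<close> is needed at once, because a flip involves only four points.\<close>

lemma perturbed_area_decreases_if_lifted:
  fixes A B C D :: "real^3" and A' B' C' D' :: "'b::real_inner"
  assumes card: "card {A, B, C, D} = 4"
    and dist: "(norm (A' - B'))\<^sup>2 = (norm (A - B))\<^sup>2 + \<epsilon>" "(norm (B' - C'))\<^sup>2 = (norm (B - C))\<^sup>2 + \<epsilon>"
      "(norm (C' - D'))\<^sup>2 = (norm (C - D))\<^sup>2 + \<epsilon>" "(norm (D' - A'))\<^sup>2 = (norm (D - A))\<^sup>2 + \<epsilon>"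
      "(norm (A' - C'))\<^sup>2 = (norm (A - C))\<^sup>2 + \<epsilon>" "(norm (B' - D'))\<^sup>2 = (norm (B - D))\<^sup>2 + \<epsilon>"
    and obtuse: "vec_angle (B' - A') (D' - A') + vec_angle (B' - C') (D' - C') \<ge> pi"
    and indep: "\<And>p q r. p *\<^sub>R (A' - B') + q *\<^sub>R (D' - B') + r *\<^sub>R (C' - B') = 0 \<Longrightarrow> p = 0 \<and> q = 0 \<and> r = 0"
    and "\<epsilon> \<ge> 0"
  shows "perturbed_area \<epsilon> {A, B, C} + perturbed_area \<epsilon> {A, C, D}
    < perturbed_area \<epsilon> {A, B, D} + perturbed_area \<epsilon> {B, C, D}"
proof -
  have ne: "A \<noteq> B" "B \<noteq> C" "C \<noteq> D" "D \<noteq> A" "A \<noteq> C" "B \<noteq> D"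
    using card by (auto simp: card_insert_if split: if_splits)
  have ne': "X' \<noteq> Y'" if "X \<noteq> Y" "(norm (X' - Y'))\<^sup>2 = (norm (X - Y))\<^sup>2 + \<epsilon>" for X Y :: "real^3" and X' Y' :: 'b
  proof -
    have "(norm (X - Y))\<^sup>2 > 0"
      using that(1) by simp
    then have "(norm (X' - Y'))\<^sup>2 > 0"
      unfolding that(2) using \<open>\<epsilon> \<ge> 0\<close> by linarith
    then show ?thesis
      by auto
  qed
  have "sqrt (heron ((norm (A' - B'))\<^sup>2) ((norm (B' - C'))\<^sup>2) ((norm (A' - C'))\<^sup>2))
      + sqrt (heron ((norm (C' - D'))\<^sup>2) ((norm (D' - A'))\<^sup>2) ((norm (A' - C'))\<^sup>2))
    < sqrt (heron ((norm (A' - B'))\<^sup>2) ((norm (D' - A'))\<^sup>2) ((norm (B' - D'))\<^sup>2))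
      + sqrt (heron ((norm (B' - C'))\<^sup>2) ((norm (C' - D'))\<^sup>2) ((norm (B' - D'))\<^sup>2))"
    using ne'[OF ne(1) dist(1)] ne'[OF ne(2) dist(2)] ne'[OF ne(3) dist(3)] ne'[OF ne(4) dist(4)]
      ne'[OF ne(5) dist(5)] ne'[OF ne(6) dist(6)] obtuse indep
    by (rule flip_decreases_area)
  moreover have "perturbed_area \<epsilon> {A, C, D}
      = sqrt (heron ((norm (C - D))\<^sup>2 + \<epsilon>) ((norm (D - A))\<^sup>2 + \<epsilon>) ((norm (A - C))\<^sup>2 + \<epsilon>))"
    using perturbed_area_heron[of C D A \<epsilon>] ne by (simp add: insert_commute norm_minus_commute[of C A])
  moreover have "perturbed_area \<epsilon> {A, B, D}
      = sqrt (heron ((norm (A - B))\<^sup>2 + \<epsilon>) ((norm (D - A))\<^sup>2 + \<epsilon>) ((norm (B - D))\<^sup>2 + \<epsilon>))"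
    using perturbed_area_heron[of B A D \<epsilon>] ne
    by (simp add: insert_commute norm_minus_commute[of B A] norm_minus_commute[of A D])
  moreover note perturbed_area_heron[OF ne(1,2,5), of \<epsilon>] perturbed_area_heron[OF ne(2,3,6), of \<epsilon>]
  ultimately show ?thesis
    unfolding dist by linarith
qed

lemma coplanar_if_combination:
  fixes X Y Z U :: "'b::real_vector"
  assumes "X - U = s *\<^sub>R (Y - U) + t *\<^sub>R (Z - U)"
  shows "coplanar {X, Y, Z, U}"
proof -
  have "X = (1 - s - t) *\<^sub>R U + s *\<^sub>R Y + t *\<^sub>R Z"
    using assms by (simp add: algebra_simps)
  then have "X \<in> affine hull {U, Y, Z}"
    unfolding affine_hull_3 by force
  then have "{X, Y, Z, U} \<subseteq> affine hull {U, Y, Z}"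
    by (simp add: hull_inc)
  then show ?thesis
    unfolding coplanar_def by blast
qed

lemma area_decreases_if_not_coplanar:
  assumes card: "card {A, B, C, D} = 4" and cop: "\<not> coplanar {A, B, C, D}"
    and angles: "angle_at B A D + angle_at B C D \<ge> pi"
  shows "perturbed_area 0 {A, B, C} + perturbed_area 0 {A, C, D}
    < perturbed_area 0 {A, B, D} + perturbed_area 0 {B, C, D}"
proof (rule perturbed_area_decreases_if_lifted[OF card, where A' = A and B' = B and C' = C and D' = D])
  fix p q r assume *: "p *\<^sub>R (A - B) + q *\<^sub>R (D - B) + r *\<^sub>R (C - B) = 0"
  have solve: "X - B = (- y / x) *\<^sub>R (Y - B) + (- z / x) *\<^sub>R (Z - B)"
    if "x *\<^sub>R (X - B) + y *\<^sub>R (Y - B) + z *\<^sub>R (Z - B) = 0" "x \<noteq> 0" for x y z X Y Z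
  proof -
    have "X - B = (1 / x) *\<^sub>R (x *\<^sub>R (X - B))"
      using that(2) by simp
    also have "x *\<^sub>R (X - B) = - (y *\<^sub>R (Y - B) + z *\<^sub>R (Z - B))"
      using that(1) by (simp only: eq_neg_iff_add_eq_0 add.assoc)
    finally show ?thesis
      by (simp add: scaleR_right_diff_distrib scaleR_add_right)
  qed
  have zero: "x = 0" if "x *\<^sub>R (X - B) + y *\<^sub>R (Y - B) + z *\<^sub>R (Z - B) = 0" "{X, Y, Z, B} = {A, B, C, D}"
    for x y z X Y Z
    using coplanar_if_combination[OF solve[OF that(1)]] cop that(2) by metis
  have "p = 0"
    using * by (rule zero) blast
  moreover have "q *\<^sub>R (D - B) + p *\<^sub>R (A - B) + r *\<^sub>R (C - B) = 0"
    using * by (simp only: add_ac)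
  then have "q = 0"
    by (rule zero) blast
  moreover have "r *\<^sub>R (C - B) + p *\<^sub>R (A - B) + q *\<^sub>R (D - B) = 0"
    using * by (simp only: add_ac)
  then have "r = 0"
    by (rule zero) blast
  ultimately show "p = 0 \<and> q = 0 \<and> r = 0"
    by simp
qed (use angles in \<open>auto simp: angle_at_eq\<close>)

text \<open>The cosine of the angle \<open>BAD\<close> of the perturbed triangle.\<close>

definition perturbed_cos :: "real \<Rightarrow> real^3 \<Rightarrow> real^3 \<Rightarrow> real^3 \<Rightarrow> real" where
  "perturbed_cos \<epsilon> B A D = ((B - A) \<bullet> (D - A) + \<epsilon> / 2) /
     (sqrt ((norm (B - A))\<^sup>2 + \<epsilon>) * sqrt ((norm (D - A))\<^sup>2 + \<epsilon>))"

text \<open>Four new directions suffice to model the perturbation of a quadruple, and they make the lifted points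
affinely independent, even if the original points are collinear.\<close>

lemma perturbed_area_decreases:
  assumes card: "card {A, B, C, D} = 4" and "\<epsilon> > 0"
    and angles: "perturbed_cos \<epsilon> B A D + perturbed_cos \<epsilon> B C D < 0"
  shows "perturbed_area \<epsilon> {A, B, C} + perturbed_area \<epsilon> {A, C, D}
    < perturbed_area \<epsilon> {A, B, D} + perturbed_area \<epsilon> {B, C, D}"
proof -
  define lift :: "4 \<Rightarrow> real^3 \<Rightarrow> (real^3) \<times> (real^4)" where
    "lift i X = (X, sqrt (\<epsilon> / 2) *\<^sub>R axis i 1)" for i X
  have dist: "(norm (lift i X - lift j Y))\<^sup>2 = (norm (X - Y))\<^sup>2 + \<epsilon>" if "i \<noteq> j" for i j X Y
    using \<open>\<epsilon> > 0\<close> that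
    by (simp add: lift_def power2_norm_eq_inner inner_Pair inner_diff inner_axis_axis real_sqrt_mult_self)
  have norm: "norm (lift i X - lift j Y) = sqrt ((norm (X - Y))\<^sup>2 + \<epsilon>)" if "i \<noteq> j" for i j X Y
    using dist[OF that, of X Y] by (metis norm_ge_zero real_sqrt_unique)
  have inner: "(lift i X - lift j Y) \<bullet> (lift k Z - lift j Y) = (X - Y) \<bullet> (Z - Y) + \<epsilon> / 2"
    if "i \<noteq> j" "k \<noteq> j" "i \<noteq> k" for i j k X Y Z
    using \<open>\<epsilon> > 0\<close> that
    by (simp add: lift_def inner_Pair inner_diff inner_axis_axis real_sqrt_mult_self)
  show ?thesis
  proof (rule perturbed_area_decreases_if_lifted[OF card,
        where A' = "lift 1 A" and B' = "lift 2 B" and C' = "lift 3 C" and D' = "lift 4 D"])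
    have "vec_angle (lift 2 B - lift 1 A) (lift 4 D - lift 1 A)
      + vec_angle (lift 2 B - lift 3 C) (lift 4 D - lift 3 C) > pi"
      unfolding vec_angle_sum_gt_pi_iff using angles by (simp add: inner norm perturbed_cos_def)
    then show "vec_angle (lift 2 B - lift 1 A) (lift 4 D - lift 1 A)
      + vec_angle (lift 2 B - lift 3 C) (lift 4 D - lift 3 C) \<ge> pi"
      by simp
  next
    fix p q r
    assume "p *\<^sub>R (lift 1 A - lift 2 B) + q *\<^sub>R (lift 4 D - lift 2 B) + r *\<^sub>R (lift 3 C - lift 2 B) = 0"
    then have "snd (p *\<^sub>R (lift 1 A - lift 2 B)
      + q *\<^sub>R (lift 4 D - lift 2 B) + r *\<^sub>R (lift 3 C - lift 2 B)) $ i = 0" for i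
      by simp
    from this[of 1] this[of 4] this[of 3] show "p = 0 \<and> q = 0 \<and> r = 0"
      using \<open>\<epsilon> > 0\<close> by (simp add: lift_def axis_def)
  qed (use \<open>\<epsilon> > 0\<close> in \<open>simp_all add: dist\<close>)
qed

lemma perturbed_cos_tendsto:
  assumes "A \<noteq> B" "A \<noteq> D"
  shows "((\<lambda>\<epsilon>. perturbed_cos \<epsilon> B A D) \<longlongrightarrow> (B - A) \<bullet> (D - A) / (norm (B - A) * norm (D - A))) (at_right 0)"
proof -
  have "((\<lambda>\<epsilon>. perturbed_cos \<epsilon> B A D) \<longlongrightarrow> perturbed_cos 0 B A D) (at_right 0)"
    unfolding perturbed_cos_def using assms by (intro tendsto_intros) auto
  then show ?thesis
    by (simp add: perturbed_cos_def)
qed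

text \<open>An angle sum above \<open>pi\<close> means a negative sum of cosines, which is an open condition; so it persists
for all sufficiently small perturbations of the finitely many quadruples.\<close>

lemma uniform_perturbation:
  assumes "finite P"
  obtains \<epsilon> where "\<epsilon> > 0" "\<And>A B C D. {A, B, C, D} \<subseteq> P \<Longrightarrow> card {A, B, C, D} = 4 \<Longrightarrow>
    angle_at B A D + angle_at B C D > pi \<Longrightarrow> perturbed_cos \<epsilon> B A D + perturbed_cos \<epsilon> B C D < 0"
proof -
  define good where "good \<epsilon> A B C D \<longleftrightarrow> (card {A, B, C, D} = 4 \<longrightarrow> angle_at B A D + angle_at B C D > pi \<longrightarrow>
    perturbed_cos \<epsilon> B A D + perturbed_cos \<epsilon> B C D < 0)" for \<epsilon> A B C D
  have "\<forall>\<^sub>F \<epsilon> in at_right 0. good \<epsilon> A B C D" for A B C D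
  proof (cases "card {A, B, C, D} = 4 \<and> angle_at B A D + angle_at B C D > pi")
    case True
    then have ne: "A \<noteq> B" "A \<noteq> D" "C \<noteq> B" "C \<noteq> D"
      by (auto simp: card_insert_if split: if_splits)
    have "\<forall>\<^sub>F \<epsilon> in at_right 0. perturbed_cos \<epsilon> B A D + perturbed_cos \<epsilon> B C D < 0"
      using tendsto_add[OF perturbed_cos_tendsto[OF ne(1,2)] perturbed_cos_tendsto[OF ne(3,4)]] True
      by (intro order_tendstoD(2)) (auto simp: angle_at_eq vec_angle_sum_gt_pi_iff)
    then show ?thesis
      by (rule eventually_mono) (simp add: good_def)
  qed (auto simp: good_def)
  then have "\<forall>\<^sub>F \<epsilon> in at_right 0. \<forall>A\<in>P. \<forall>B\<in>P. \<forall>C\<in>P. \<forall>D\<in>P. good \<epsilon> A B C D"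
    using assms by (intro eventually_ball_finite ballI)
  then have "\<forall>\<^sub>F \<epsilon> in at_right 0. (\<forall>A\<in>P. \<forall>B\<in>P. \<forall>C\<in>P. \<forall>D\<in>P. good \<epsilon> A B C D) \<and> 0 < \<epsilon>"
    using eventually_at_right_less[of 0] by (rule eventually_conj)
  then have "\<exists>\<epsilon>. (\<forall>A\<in>P. \<forall>B\<in>P. \<forall>C\<in>P. \<forall>D\<in>P. good \<epsilon> A B C D) \<and> 0 < \<epsilon>"
    by (rule eventually_happens'[OF trivial_limit_at_right_real])
  then obtain \<epsilon> where "\<And>A B C D. {A, B, C, D} \<subseteq> P \<Longrightarrow> good \<epsilon> A B C D" "0 < \<epsilon>"
    by blast
  then show thesis
    using that[of \<epsilon>] unfolding good_def by blast
qed

section \<open>Gluing of parametrized triangles\<close>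

text \<open>The reparametrization of the model triangle that occurs in the gluing condition of
\<open>surface_triangulation\<close>.\<close>

definition permute :: "(3 \<Rightarrow> 3) \<Rightarrow> real^3 \<Rightarrow> real^3" where
  "permute \<pi> x = (\<chi> i. x $ \<pi> i)"

text \<open>The gluing condition of \<open>surface_triangulation\<close> at a single point.  Pointwise it is almost an
equivalence relation (\<open>glued_sym\<close>, \<open>glued_trans\<close>), which allows new triangles to be compared with the
remaining ones through the old triangles from which they are cut.\<close>

definition glued :: "(real^3 \<Rightarrow> 'a) \<Rightarrow> (real^3 \<Rightarrow> 'a) \<Rightarrow> 'a \<Rightarrow> bool" where
  "glued \<sigma> \<tau> p \<longleftrightarrow> (\<exists>I \<pi>. I \<noteq> UNIV \<and> bij \<pi> \<and> p \<in> \<sigma> ` face I \<and> (\<forall>x\<in>face I. \<sigma> x = \<tau> (permute \<pi> x)))"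

definition meet_properly :: "(real^3 \<Rightarrow> 'a) \<Rightarrow> (real^3 \<Rightarrow> 'a) \<Rightarrow> bool" where
  "meet_properly \<sigma> \<tau> \<longleftrightarrow> (\<forall>p \<in> \<sigma> ` std_triangle \<inter> \<tau> ` std_triangle. glued \<sigma> \<tau> p)"

definition embedded_triangle :: "'a topology \<Rightarrow> (real^3 \<Rightarrow> 'a) \<Rightarrow> bool" where
  "embedded_triangle S \<sigma> \<longleftrightarrow> continuous_map (top_of_set std_triangle) S \<sigma> \<and> inj_on \<sigma> std_triangle"

abbreviation carrier :: "(real^3 \<Rightarrow> 'a) \<Rightarrow> 'a set" where
  "carrier \<sigma> \<equiv> \<sigma> ` std_triangle"

abbreviation corners :: "(real^3 \<Rightarrow> 'a) \<Rightarrow> 'a set" where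
  "corners \<sigma> \<equiv> \<sigma> ` range corner"

lemma surface_triangulation_iff:
  "surface_triangulation S T V \<longleftrightarrow>
     finite T \<and> (\<forall>\<sigma>\<in>T. embedded_triangle S \<sigma>) \<and> topspace S = (\<Union>\<sigma>\<in>T. carrier \<sigma>) \<and>
     V = (\<Union>\<sigma>\<in>T. corners \<sigma>) \<and> pairwise meet_properly T"
  unfolding surface_triangulation_def embedded_triangle_def meet_properly_def glued_def permute_def pairwise_def
  by (simp only:)

lemma permute_nth [simp]: "permute \<pi> x $ i = x $ \<pi> i"
  by (simp add: permute_def)

lemma permute_compose: "permute \<kappa> (permute \<pi> x) = permute (\<pi> \<circ> \<kappa>) x"
  by (simp add: vec_eq_iff)

lemma permute_inv: "bij \<pi> \<Longrightarrow> permute (inv \<pi>) (permute \<pi> x) = x" "bij \<pi> \<Longrightarrow> permute \<pi> (permute (inv \<pi>) x) = x"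
  by (simp_all add: vec_eq_iff surj_f_inv_f[OF bij_is_surj] inv_f_f[OF bij_is_inj])

lemma permute_std: "bij \<pi> \<Longrightarrow> x \<in> std_triangle \<Longrightarrow> permute \<pi> x \<in> std_triangle"
  using sum.reindex_bij_betw[of \<pi> UNIV UNIV "\<lambda>i. x $ i"] by (simp add: std_triangle_def)

lemma permute_std_image: "bij \<pi> \<Longrightarrow> permute \<pi> ` std_triangle = std_triangle"
proof (intro equalityI subsetI)
  fix x assume "bij \<pi>" "x \<in> std_triangle"
  then show "x \<in> permute \<pi> ` std_triangle"
    by (metis bij_imp_bij_inv imageI permute_inv(2) permute_std)
qed (auto intro: permute_std)

lemma permute_corner: "bij \<pi> \<Longrightarrow> permute \<pi> (corner (\<pi> i)) = corner i"
  by (auto simp: vec_eq_iff corner_def axis_def dest: bij_is_inj injD)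

lemma continuous_permute: "continuous_on A (permute \<pi>)"
  unfolding permute_def by (intro continuous_intros)

lemma face_subset: "face I \<subseteq> std_triangle"
  by (auto simp: face_def)

lemma corner_in_std: "corner i \<in> std_triangle"
  by (auto simp: std_triangle_def corner_def axis_def)

lemma corner_in_face_iff: "corner i \<in> face I \<longleftrightarrow> i \<in> I"
  using corner_in_std by (auto simp: face_def corner_def axis_def)

lemma face_Int: "face (I \<inter> J) = face I \<inter> face J"
  by (auto simp: face_def)

lemma permute_face_iff:
  assumes "bij \<pi>" "x \<in> std_triangle"
  shows "permute \<pi> x \<in> face J \<longleftrightarrow> x \<in> face (\<pi> ` J)"
proof -
  have "(\<forall>i. i \<notin> \<pi> ` J \<longrightarrow> x $ i = 0) \<longleftrightarrow> (\<forall>i. \<pi> i \<notin> \<pi> ` J \<longrightarrow> x $ \<pi> i = 0)"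
    using bij_is_surj[OF assms(1)] by (metis surj_def)
  also have "\<dots> \<longleftrightarrow> (\<forall>i. i \<notin> J \<longrightarrow> x $ \<pi> i = 0)"
    using bij_is_inj[OF assms(1)] by (simp add: inj_image_mem_iff)
  finally show ?thesis
    unfolding face_def using assms permute_std by auto
qed

lemma gluedE:
  assumes "glued \<sigma> \<tau> p"
  obtains I \<pi> x where "I \<noteq> UNIV" "bij \<pi>" "x \<in> face I" "p = \<sigma> x"
    "\<And>x. x \<in> face I \<Longrightarrow> \<sigma> x = \<tau> (permute \<pi> x)"
  using assms unfolding glued_def by blast

lemma gluedI:
  assumes "I \<noteq> UNIV" "bij \<pi>" "x \<in> face I" "\<And>x. x \<in> face I \<Longrightarrow> \<sigma> x = \<tau> (permute \<pi> x)"
  shows "glued \<sigma> \<tau> (\<sigma> x)"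
  unfolding glued_def
proof (intro exI conjI ballI)
  show "\<sigma> x \<in> \<sigma> ` face I"
    using assms(3) by (rule imageI)
qed (fact assms)+

lemma glued_sym:
  assumes "glued \<sigma> \<tau> p"
  shows "glued \<tau> \<sigma> p"
proof -
  obtain I \<pi> x where I: "I \<noteq> UNIV" "bij \<pi>" "x \<in> face I" "p = \<sigma> x" "\<And>x. x \<in> face I \<Longrightarrow> \<sigma> x = \<tau> (permute \<pi> x)"
    using assms by (rule gluedE) (rule that)
  let ?J = "inv \<pi> ` I"
  have J: "\<pi> ` ?J = I"
    using I(2) by (simp add: bij_is_surj image_f_inv_f)
  have "?J \<noteq> UNIV"
    using I J by (metis bij_is_surj)
  moreover have "p \<in> \<tau> ` face ?J"
  proof -
    have "permute \<pi> x \<in> face ?J"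
      using I(3) face_subset[of I] permute_face_iff[OF I(2), of x ?J] unfolding J by blast
    then show ?thesis
      using I(5)[OF I(3)] I(4) by blast
  qed
  moreover have "\<tau> y = \<sigma> (permute (inv \<pi>) y)" if "y \<in> face ?J" for y
  proof -
    have "permute (inv \<pi>) y \<in> face I"
      using that permute_face_iff[OF bij_imp_bij_inv[OF I(2)], of y I] face_subset[of ?J] by blast
    then show ?thesis
      using I(5) permute_inv(2)[OF I(2)] by simp
  qed
  ultimately show ?thesis
    unfolding glued_def using bij_imp_bij_inv[OF I(2)] by blast
qed

text \<open>The common face is the intersection of the two faces, carried to the first triangle.  Injectivity of
the middle parametrization ensures that both gluings see the same preimage of \<open>p\<close>.\<close>

lemma glued_trans:
  assumes "glued \<sigma> \<tau> p" "glued \<tau> \<rho> p" "inj_on \<tau> std_triangle"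
  shows "glued \<sigma> \<rho> p"
proof -
  obtain I \<pi> x where I: "I \<noteq> UNIV" "bij \<pi>" "x \<in> face I" "p = \<sigma> x" "\<And>x. x \<in> face I \<Longrightarrow> \<sigma> x = \<tau> (permute \<pi> x)"
    using assms(1) by (rule gluedE) (rule that)
  obtain J \<kappa> y where J: "J \<noteq> UNIV" "bij \<kappa>" "y \<in> face J" "p = \<tau> y" "\<And>x. x \<in> face J \<Longrightarrow> \<tau> x = \<rho> (permute \<kappa> x)"
    using assms(2) by (rule gluedE) (rule that)
  have std: "x \<in> std_triangle" "y \<in> std_triangle" "permute \<pi> x \<in> std_triangle"
    using I(3) J(3) face_subset permute_std[OF I(2)] by blast+
  have "permute \<pi> x = y"
    using I(5)[OF I(3)] I(4) J(4) std inj_onD[OF assms(3)] by metis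
  then have x: "x \<in> face (I \<inter> \<pi> ` J)"
    using permute_face_iff[OF I(2) std(1), of J] I(3) J(3) by (simp add: face_Int)
  have agree: "\<sigma> z = \<rho> (permute (\<pi> \<circ> \<kappa>) z)" if "z \<in> face (I \<inter> \<pi> ` J)" for z
  proof -
    have z: "z \<in> face I" "z \<in> face (\<pi> ` J)"
      using that by (simp_all add: face_Int)
    then have "permute \<pi> z \<in> face J"
      using permute_face_iff[OF I(2), of z J] face_subset[of I] by blast
    then show ?thesis
      using I(5)[OF z(1)] J(5) by (simp add: permute_compose)
  qed
  show ?thesis
    unfolding glued_def
  proof (intro exI conjI ballI)
    show "I \<inter> \<pi> ` J \<noteq> UNIV"
      using I(1) by simp
    show "p \<in> \<sigma> ` face (I \<inter> \<pi> ` J)"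
      unfolding I(4) using x by (rule imageI)
    show "bij (\<pi> \<circ> \<kappa>)"
      using bij_comp[OF J(2) I(2)] .
  qed (fact agree)
qed

lemma meet_properly_sym: "meet_properly \<sigma> \<tau> \<Longrightarrow> meet_properly \<tau> \<sigma>"
  by (auto simp: meet_properly_def intro: glued_sym)

text \<open>The face at which \<open>\<sigma>\<close> is glued is a proper one, and it contains the only preimage of the point.\<close>

lemma glued_zero_coordinate:
  assumes "glued \<sigma> \<tau> (\<sigma> x)" "inj_on \<sigma> std_triangle" "x \<in> std_triangle"
  shows "\<exists>i. x $ i = 0"
proof -
  obtain I y where I: "I \<noteq> UNIV" "y \<in> face I" "\<sigma> x = \<sigma> y"
    using assms(1) by (auto simp: glued_def)
  then have "x = y"
    using assms face_subset by (meson inj_onD subsetD)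
  then show ?thesis
    using I by (auto simp: face_def)
qed

lemma embedded_permute:
  assumes "embedded_triangle S \<sigma>" "bij \<pi>"
  shows "embedded_triangle S (\<sigma> \<circ> permute \<pi>)"
proof -
  have "continuous_map (top_of_set std_triangle) (top_of_set std_triangle) (permute \<pi>)"
    using assms(2) permute_std by (auto simp: continuous_permute)
  moreover have "inj (permute \<pi>)"
    using permute_inv(1)[OF assms(2)] by (metis injI)
  ultimately show ?thesis
    using assms unfolding embedded_triangle_def
    by (metis comp_inj_on continuous_map_compose inj_on_subset permute_std_image subset_UNIV)
qed

lemma carrier_permute: "bij \<pi> \<Longrightarrow> carrier (\<sigma> \<circ> permute \<pi>) = carrier \<sigma>"
  using permute_std_image[of \<pi>] by (metis image_comp)

lemma corners_permute:
  assumes "bij \<pi>"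
  shows "corners (\<sigma> \<circ> permute \<pi>) = corners \<sigma>"
proof -
  have "permute \<pi> ` range corner = permute \<pi> ` corner ` range \<pi>"
    using assms by (simp add: bij_is_surj)
  also have "\<dots> = range corner"
    by (simp add: image_image permute_corner[OF assms])
  finally have "permute \<pi> ` range corner = range corner" .
  then show ?thesis
    by (metis image_comp)
qed

lemma glued_permute:
  assumes "glued \<sigma> \<tau> p" "bij \<kappa>"
  shows "glued (\<sigma> \<circ> permute \<kappa>) \<tau> p"
proof -
  obtain I \<pi> x where I: "I \<noteq> UNIV" "bij \<pi>" "x \<in> face I" "p = \<sigma> x" "\<And>x. x \<in> face I \<Longrightarrow> \<sigma> x = \<tau> (permute \<pi> x)"
    using assms(1) by (rule gluedE) (rule that)
  have x: "x \<in> std_triangle" "permute (inv \<kappa>) x \<in> std_triangle"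
    using I(3) face_subset[of I] permute_std[OF bij_imp_bij_inv[OF assms(2)]] by blast+
  have "\<kappa> ` I \<noteq> UNIV"
    using I(1) assms(2) by (metis bij_is_inj bij_is_surj inj_image_eq_iff)
  moreover have "permute (inv \<kappa>) x \<in> face (\<kappa> ` I)"
    using I(3) x permute_face_iff[OF assms(2) x(2), of I] permute_inv(2)[OF assms(2), of x] by simp
  then have "p \<in> (\<sigma> \<circ> permute \<kappa>) ` face (\<kappa> ` I)"
    using I(4) permute_inv(2)[OF assms(2), of x] by (metis comp_apply imageI)
  moreover have "(\<sigma> \<circ> permute \<kappa>) z = \<tau> (permute (\<kappa> \<circ> \<pi>) z)" if "z \<in> face (\<kappa> ` I)" for z
    using that I(5)[of "permute \<kappa> z"] permute_face_iff[OF assms(2), of z I] face_subset[of "\<kappa> ` I"]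
    by (metis comp_apply permute_compose subsetD)
  moreover have "bij (\<kappa> \<circ> \<pi>)"
    using I(2) assms(2) by (metis bij_comp)
  ultimately show ?thesis
    unfolding glued_def by blast
qed

lemma meet_properly_permute:
  "meet_properly \<sigma> \<tau> \<Longrightarrow> bij \<pi> \<Longrightarrow> meet_properly (\<sigma> \<circ> permute \<pi>) \<tau>"
  unfolding meet_properly_def by (simp only: carrier_permute) (metis glued_permute)

lemma triangle_centre: "(\<chi> i. 1/3) \<in> std_triangle"
  by (simp add: std_triangle_def)

text \<open>Otherwise the centre of \<open>\<sigma>\<close> would be glued to \<open>\<tau>\<close>, although it is not a boundary
point.  This is how the triangles made by a flip are seen to be new elements of the triangulation.\<close>

lemma carrier_neq_if_meet_properly:
  assumes "meet_properly \<sigma> \<tau>" "inj_on \<sigma> std_triangle"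
  shows "carrier \<sigma> \<noteq> carrier \<tau>"
proof
  assume "carrier \<sigma> = carrier \<tau>"
  then have "glued \<sigma> \<tau> (\<sigma> (\<chi> i. 1/3))"
    using assms(1) triangle_centre unfolding meet_properly_def by blast
  then show False
    using glued_zero_coordinate[OF _ assms(2) triangle_centre] by auto
qed

section \<open>Piecewise linear extension of vertex maps\<close>

text \<open>On a common face, the barycentric combinations of vertex values that belong to the two triangles agree
because gluings send corners to corners.\<close>

lemma sum_permute_corner:
  fixes g :: "'a \<Rightarrow> real^3"
  assumes "x \<in> face I" "bij \<pi>" "\<And>x. x \<in> face I \<Longrightarrow> \<sigma> x = \<tau> (permute \<pi> x)"
  shows "(\<Sum>i\<in>UNIV. x $ i *\<^sub>R g (\<sigma> (corner i))) = (\<Sum>i\<in>UNIV. permute \<pi> x $ i *\<^sub>R g (\<tau> (corner i)))"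
proof -
  have "(\<Sum>i\<in>UNIV. x $ i *\<^sub>R g (\<sigma> (corner i))) = (\<Sum>i\<in>UNIV. x $ \<pi> i *\<^sub>R g (\<sigma> (corner (\<pi> i))))"
    using sum.reindex_bij_betw[of \<pi> UNIV UNIV "\<lambda>i. x $ i *\<^sub>R g (\<sigma> (corner i))"] assms(2) by simp
  also have "\<dots> = (\<Sum>i\<in>UNIV. permute \<pi> x $ i *\<^sub>R g (\<tau> (corner i)))"
  proof (rule sum.cong[OF refl])
    fix i
    show "x $ \<pi> i *\<^sub>R g (\<sigma> (corner (\<pi> i))) = permute \<pi> x $ i *\<^sub>R g (\<tau> (corner i))"
    proof (cases "\<pi> i \<in> I")
      case True
      then show ?thesis
        using assms(3)[of "corner (\<pi> i)"] permute_corner[OF assms(2)] by (simp add: corner_in_face_iff)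
    next
      case False
      then show ?thesis
        using assms(1) by (simp add: face_def)
    qed
  qed
  finally show ?thesis .
qed

lemma compact_std_triangle: "compact std_triangle"
proof (rule compact_eq_bounded_closed[THEN iffD2, OF conjI])
  have "std_triangle \<subseteq> cbox 0 1"
  proof
    fix x assume x: "x \<in> std_triangle"
    have "x $ i \<le> 1" for i
    proof -
      have "x $ i \<le> (\<Sum>i\<in>UNIV. x $ i)"
        using x by (intro member_le_sum) (auto simp: std_triangle_def)
      then show ?thesis
        using x by (simp add: std_triangle_def)
    qed
    then show "x \<in> cbox 0 1"
      using x by (simp add: std_triangle_def mem_box_cart)
  qed
  then show "bounded std_triangle"
    using bounded_cbox bounded_subset by blast
  show "closed std_triangle"
    unfolding std_triangle_def
    by (intro closed_Collect_conj closed_Collect_all closed_Collect_le closed_Collect_eq continuous_intros)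
qed

text \<open>The affine extensions to the single triangles agree on overlaps because gluings are affine and match
corners.  The resulting map is continuous because preimages of closed sets are finite unions of
continuous images of compact sets.\<close>

lemma realization_extends_vertex_map:
  fixes g :: "'a \<Rightarrow> real^3"
  assumes haus: "Hausdorff_space S" and tri: "surface_triangulation S T V" and bij: "bij_betw g V P"
  obtains h where "realization S T V P h" "\<And>v. v \<in> V \<Longrightarrow> h v = g v"
proof -
  have T: "finite T" "\<And>\<sigma>. \<sigma> \<in> T \<Longrightarrow> embedded_triangle S \<sigma>" "topspace S = (\<Union>\<sigma>\<in>T. carrier \<sigma>)"
      "V = (\<Union>\<sigma>\<in>T. corners \<sigma>)" "pairwise meet_properly T"
    using tri by (auto simp: surface_triangulation_iff)
  define lin where "lin \<sigma> x = (\<Sum>i\<in>UNIV. x $ i *\<^sub>R g (\<sigma> (corner i)))" for \<sigma> x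
  have agree: "lin \<sigma> x = lin \<tau> y"
    if "\<sigma> \<in> T" "\<tau> \<in> T" "x \<in> std_triangle" "y \<in> std_triangle" "\<sigma> x = \<tau> y" for \<sigma> \<tau> x y
  proof (cases "\<sigma> = \<tau>")
    case True
    then show ?thesis
      using that T(2) by (auto simp: embedded_triangle_def dest: inj_onD)
  next
    case False
    then have "meet_properly \<sigma> \<tau>"
      using T(5) that by (simp add: pairwise_def)
    moreover have "\<sigma> x \<in> carrier \<sigma> \<inter> carrier \<tau>"
      using that by blast
    ultimately have "glued \<sigma> \<tau> (\<sigma> x)"
      by (simp only: meet_properly_def)
    then obtain I \<pi> z where I: "I \<noteq> UNIV" "bij \<pi>" "z \<in> face I" "\<sigma> x = \<sigma> z"
        "\<And>x. x \<in> face I \<Longrightarrow> \<sigma> x = \<tau> (permute \<pi> x)"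
      by (rule gluedE) (rule that)
    have "z \<in> std_triangle" "permute \<pi> z \<in> std_triangle"
      using I(3) face_subset permute_std[OF I(2)] by blast+
    moreover have "\<tau> y = \<tau> (permute \<pi> z)"
      using I that(5) by simp
    ultimately have "x = z" "y = permute \<pi> z"
      using I(4) that T(2) unfolding embedded_triangle_def by (meson inj_onD)+
    then show ?thesis
      unfolding lin_def using sum_permute_corner[of z I \<pi> \<sigma> \<tau>, OF I(3,2,5)] by simp
  qed
  define h where "h p = (SOME q. \<exists>\<sigma>\<in>T. \<exists>x\<in>std_triangle. p = \<sigma> x \<and> q = lin \<sigma> x)" for p
  have h: "h (\<sigma> x) = lin \<sigma> x" if "\<sigma> \<in> T" "x \<in> std_triangle" for \<sigma> x
  proof -
    have "\<exists>q. \<exists>\<tau>\<in>T. \<exists>y\<in>std_triangle. \<sigma> x = \<tau> y \<and> q = lin \<tau> y"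
      using that by blast
    then have "\<exists>\<tau>\<in>T. \<exists>y\<in>std_triangle. \<sigma> x = \<tau> y \<and> h (\<sigma> x) = lin \<tau> y"
      unfolding h_def by (rule someI_ex)
    then show ?thesis
      using agree that by metis
  qed
  have lin_corner: "lin \<sigma> (corner i) = g (\<sigma> (corner i))" for \<sigma> i
    by (simp add: lin_def corner_def axis_def if_distrib[of "\<lambda>c. c *\<^sub>R _"] cong: if_cong)
  have hg: "h v = g v" if "v \<in> V" for v
    using that h corner_in_std by (auto simp: T(4) lin_corner)
  have "continuous_map S euclidean h"
    unfolding continuous_map_closedin
  proof (intro conjI allI impI)
    fix K :: "(real^3) set" assume "closedin euclidean K"
    then have K: "closed K"
      by simp
    have "{p \<in> topspace S. h p \<in> K} = (\<Union>\<sigma>\<in>T. \<sigma> ` {x \<in> std_triangle. lin \<sigma> x \<in> K})"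
      using h by (auto simp: T(3))
    moreover have "closedin S (\<sigma> ` {x \<in> std_triangle. lin \<sigma> x \<in> K})" if "\<sigma> \<in> T" for \<sigma>
    proof (rule compactin_imp_closedin[OF haus], rule image_compactin)
      show "continuous_map (top_of_set std_triangle) S \<sigma>"
        using T(2)[OF that] by (simp add: embedded_triangle_def)
      have "closed (lin \<sigma> -` K)"
        unfolding lin_def using K by (intro closed_vimage continuous_intros)
      then have "compact (std_triangle \<inter> lin \<sigma> -` K)"
        by (rule compact_Int_closed[OF compact_std_triangle])
      moreover have "std_triangle \<inter> lin \<sigma> -` K = {x \<in> std_triangle. lin \<sigma> x \<in> K}"
        by auto
      ultimately have "compact {x \<in> std_triangle. lin \<sigma> x \<in> K}"
        by simp
      then show "compactin (top_of_set std_triangle) {x \<in> std_triangle. lin \<sigma> x \<in> K}"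
        by (auto simp: compactin_subtopology)
    qed
    ultimately show "closedin S {p \<in> topspace S. h p \<in> K}"
      using T(1) by (auto intro: closedin_Union)
  qed auto
  then have "realization S T V P h"
    unfolding realization_def using bij hg
    by (simp add: h corner_in_std lin_corner cong: bij_betw_cong) (simp add: lin_def)
  then show thesis
    using hg that by blast
qed

section \<open>The quadrilateral formed by two triangles with a common edge\<close>

text \<open>Two embedded triangles with a common edge, parametrized alike along it, such that the edge is opposite
to \<open>corner 1\<close> in both and the two opposite vertices differ.  With \<open>a\<close>, \<open>c\<close> for these vertices and \<open>b\<close>,
\<open>d\<close> for the ends of the edge, the triangles are \<open>abd\<close> and \<open>cbd\<close>.\<close>

definition hinge :: "'a topology \<Rightarrow> (real^3 \<Rightarrow> 'a) \<Rightarrow> (real^3 \<Rightarrow> 'a) \<Rightarrow> bool" where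
  "hinge S \<sigma> \<tau> \<longleftrightarrow> embedded_triangle S \<sigma> \<and> embedded_triangle S \<tau> \<and> meet_properly \<sigma> \<tau> \<and>
     (\<forall>x\<in>face {2, 3}. \<sigma> x = \<tau> x) \<and> \<sigma> (corner 1) \<noteq> \<tau> (corner 1)"

lemma std_triangle_3: "x \<in> std_triangle \<longleftrightarrow> 0 \<le> x $ 1 \<and> 0 \<le> x $ 2 \<and> 0 \<le> x $ 3 \<and> x $ 1 + x $ 2 + x $ 3 = 1"
  by (simp add: std_triangle_def forall_3 sum_3)

lemma face_23: "x \<in> face {2, 3} \<longleftrightarrow> x \<in> std_triangle \<and> x $ 1 = 0"
  by (auto simp: face_def forall_3)

lemma corner_nth: "corner i $ j = (if j = i then 1 else 0)"
  by (simp add: corner_def axis_def)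

lemma hinge_sym: "hinge S \<sigma> \<tau> \<Longrightarrow> hinge S \<tau> \<sigma>"
  by (auto simp: hinge_def intro: meet_properly_sym)

text \<open>Together with \<open>hinge_sym\<close>, exchanging the ends of the common edge generates the symmetries of the
quadrilateral, so that only one of its four sides has to be treated explicitly.\<close>

lemma hinge_permute_23:
  assumes "hinge S \<sigma> \<tau>"
  shows "hinge S (\<sigma> \<circ> permute (Transposition.transpose 2 3)) (\<tau> \<circ> permute (Transposition.transpose 2 3))"
proof -
  let ?s = "Transposition.transpose 2 3 :: 3 \<Rightarrow> 3"
  have s: "bij ?s"
    by (rule bij_transpose)
  have "permute ?s (corner 1) = corner 1"
    using permute_corner[OF s, of 1] by simp
  moreover have "permute ?s x \<in> face {2, 3}" if "x \<in> face {2, 3}" for x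
    using that by (simp add: face_23 permute_std[OF s])
  moreover have "meet_properly (\<sigma> \<circ> permute ?s) (\<tau> \<circ> permute ?s)"
    using assms meet_properly_permute[OF meet_properly_sym[OF meet_properly_permute[OF meet_properly_sym s]] s]
      meet_properly_sym by (metis hinge_def meet_properly_permute meet_properly_sym s)
  ultimately show ?thesis
    using assms embedded_permute[OF _ s, of S \<sigma>] embedded_permute[OF _ s, of S \<tau>] by (simp add: hinge_def)
qed

text \<open>The triangles meet in the common edge only: any common face that contained \<open>corner 1\<close> would identify
the vertex \<open>a\<close> with one of the vertices \<open>b\<close>, \<open>c\<close>, \<open>d\<close>.\<close>

lemma hinge_overlap:
  assumes "hinge S \<sigma> \<tau>" "x \<in> std_triangle" "y \<in> std_triangle" "\<sigma> x = \<tau> y"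
  shows "x = y" "x $ 1 = 0"
proof -
  have inj: "inj_on \<sigma> std_triangle" "inj_on \<tau> std_triangle"
    and edge: "\<And>x. x \<in> face {2, 3} \<Longrightarrow> \<sigma> x = \<tau> x" and apex: "\<sigma> (corner 1) \<noteq> \<tau> (corner 1)"
    using assms(1) by (auto simp: hinge_def embedded_triangle_def)
  have "\<sigma> x \<in> carrier \<sigma> \<inter> carrier \<tau>"
    using assms by blast
  then have "glued \<sigma> \<tau> (\<sigma> x)"
    using assms(1) by (simp only: hinge_def meet_properly_def)
  then obtain I \<pi> z where I: "I \<noteq> UNIV" "bij \<pi>" "z \<in> face I" "\<sigma> x = \<sigma> z"
      "\<And>x. x \<in> face I \<Longrightarrow> \<sigma> x = \<tau> (permute \<pi> x)"
    by (rule gluedE) (rule that)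
  \<comment> \<open>otherwise the vertex a would be identified with a vertex of the second triangle\<close>
  have "1 \<notin> I"
  proof
    assume "1 \<in> I"
    then have *: "\<sigma> (corner 1) = \<tau> (permute \<pi> (corner 1))"
      by (simp add: I(5) corner_in_face_iff)
    obtain j where "\<pi> j = 1"
      using I(2) by (metis bij_pointE)
    then have "\<sigma> (corner 1) = \<tau> (corner j)"
      using * permute_corner[OF I(2), of j] by simp
    moreover have "\<tau> (corner j) = \<sigma> (corner j)" if "j \<noteq> 1"
      using that edge[of "corner j"] exhaust_3[of j] by (auto simp: corner_in_face_iff)
    moreover have "corner 1 \<noteq> corner j" if "j \<noteq> 1"
      using that by (metis corner_nth zero_neq_one)
    ultimately show False
      using apex inj_onD[OF inj(1), of "corner 1" "corner j"] corner_in_std by (cases "j = 1") auto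
  qed
  moreover have xz: "x = z"
    using inj_onD[OF inj(1) I(4)] assms(2) I(3) face_subset by blast
  moreover have "z \<in> std_triangle \<and> (1 \<notin> I \<longrightarrow> z $ 1 = 0)"
    using I(3) by (simp add: face_def)
  ultimately have x: "x \<in> face {2, 3}"
    by (simp add: face_23)
  then show "x $ 1 = 0"
    by (simp add: face_23)
  have "\<tau> x = \<tau> y"
    using edge[OF x] assms(4) by simp
  then show "x = y"
    using inj_onD[OF inj(2)] assms by blast
qed

text \<open>The model quadrilateral.  Its vertices \<open>(-1, 0)\<close>, \<open>(0, -1)\<close>, \<open>(1, 0)\<close>, \<open>(0, 1)\<close> stand for \<open>a\<close>, \<open>b\<close>,
\<open>c\<close>, \<open>d\<close>, so that the old diagonal is vertical and the new one is horizontal.\<close>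

definition diamond :: "(real^2) set" where
  "diamond = {z. \<bar>z $ 1\<bar> + \<bar>z $ 2\<bar> \<le> 1}"

text \<open>Barycentric coordinates of a point of the left half of the diamond, extended to the right half by
reflection in the vertical diagonal.  So the same coordinates serve for both triangles.\<close>

definition fold_coords :: "real^2 \<Rightarrow> real^3" where
  "fold_coords z = vector [\<bar>z $ 1\<bar>, (1 - \<bar>z $ 1\<bar> - z $ 2) / 2, (1 - \<bar>z $ 1\<bar> + z $ 2) / 2]"

definition quad :: "(real^3 \<Rightarrow> 'a) \<Rightarrow> (real^3 \<Rightarrow> 'a) \<Rightarrow> real^2 \<Rightarrow> 'a" where
  "quad \<sigma> \<tau> z = (if z $ 1 \<le> 0 then \<sigma> else \<tau>) (fold_coords z)"

lemma fold_coords_std: "z \<in> diamond \<Longrightarrow> fold_coords z \<in> std_triangle"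
  by (auto simp: diamond_def fold_coords_def std_triangle_3 field_simps)

lemma fold_coords_nth:
  "fold_coords z $ 1 = \<bar>z $ 1\<bar>" "fold_coords z $ 2 = (1 - \<bar>z $ 1\<bar> - z $ 2) / 2"
  "fold_coords z $ 3 = (1 - \<bar>z $ 1\<bar> + z $ 2) / 2"
  by (simp_all add: fold_coords_def)

lemma continuous_fold_coords: "continuous_on A fold_coords"
proof -
  have "continuous_on A (\<lambda>z. fold_coords z $ i)" for i
    using exhaust_3[of i]
    by (elim disjE; hypsubst; unfold fold_coords_nth) (auto intro!: continuous_intros)
  then have "continuous_on A (\<lambda>z. \<chi> i. fold_coords z $ i)"
    by (rule continuous_on_vec_lambda)
  then show ?thesis
    by simp
qed

lemma fold_coords_eq_iff: "fold_coords z = fold_coords w \<longleftrightarrow> \<bar>z $ 1\<bar> = \<bar>w $ 1\<bar> \<and> z $ 2 = w $ 2"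
  by (auto simp: vec_eq_iff forall_3 fold_coords_nth)

lemma continuous_quad:
  assumes "hinge S \<sigma> \<tau>"
  shows "continuous_map (top_of_set diamond) S (quad \<sigma> \<tau>)"
  unfolding quad_def if_distribR
proof (rule continuous_map_cases_le)
  show "continuous_map (top_of_set diamond) euclideanreal (\<lambda>z. z $ 1)"
    "continuous_map (top_of_set diamond) euclideanreal (\<lambda>z. 0)"
    by (auto intro: continuous_intros)
  have fc: "continuous_map (subtopology (top_of_set diamond) A) (top_of_set std_triangle) fold_coords" for A
    using fold_coords_std by (auto simp: subtopology_subtopology continuous_fold_coords)
  show "continuous_map (subtopology (top_of_set diamond) {z \<in> topspace (top_of_set diamond). z $ 1 \<le> 0}) S
      (\<lambda>z. \<sigma> (fold_coords z))"
    using continuous_map_compose[OF fc] assms by (auto simp: hinge_def embedded_triangle_def o_def)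
  show "continuous_map (subtopology (top_of_set diamond) {z \<in> topspace (top_of_set diamond). 0 \<le> z $ 1}) S
      (\<lambda>z. \<tau> (fold_coords z))"
    using continuous_map_compose[OF fc] assms by (auto simp: hinge_def embedded_triangle_def o_def)
  show "\<sigma> (fold_coords z) = \<tau> (fold_coords z)" if "z \<in> topspace (top_of_set diamond)" "z $ 1 = 0" for z
    using that assms fold_coords_std[of z] by (auto simp: hinge_def face_23 fold_coords_nth)
qed

lemma quad_pos: "hinge S \<sigma> \<tau> \<Longrightarrow> z \<in> diamond \<Longrightarrow> 0 \<le> z $ 1 \<Longrightarrow> quad \<sigma> \<tau> z = \<tau> (fold_coords z)"
  using fold_coords_std[of z] by (auto simp: quad_def hinge_def face_23 fold_coords_nth)

lemma inj_on_quad: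
  assumes "hinge S \<sigma> \<tau>"
  shows "inj_on (quad \<sigma> \<tau>) diamond"
proof (rule inj_onI)
  fix z w assume zw: "z \<in> diamond" "w \<in> diamond" "quad \<sigma> \<tau> z = quad \<sigma> \<tau> w"
  have std: "fold_coords z \<in> std_triangle" "fold_coords w \<in> std_triangle"
    using zw fold_coords_std by auto
  have inj: "inj_on \<sigma> std_triangle" "inj_on \<tau> std_triangle"
    using assms by (auto simp: hinge_def embedded_triangle_def)
  have same: "z = w" if "fold_coords z = fold_coords w" "z $ 1 \<le> 0 \<longleftrightarrow> w $ 1 \<le> 0"
    using that unfolding fold_coords_eq_iff by (auto simp: vec_eq_iff[of z w] forall_2 abs_if split: if_splits)
  have cross: False
    if "\<sigma> (fold_coords u) = \<tau> (fold_coords v)" "u \<in> diamond" "v \<in> diamond" "v $ 1 > 0" for u v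
  proof -
    have "fold_coords u = fold_coords v" "fold_coords u $ 1 = 0"
      using hinge_overlap[OF assms _ _ that(1)] that fold_coords_std by blast+
    then have "fold_coords v $ 1 = 0"
      by simp
    then show False
      using that(4) by (simp add: fold_coords_nth)
  qed
  show "z = w"
  proof (cases "z $ 1 \<le> 0"; cases "w $ 1 \<le> 0")
    assume "z $ 1 \<le> 0" "w $ 1 \<le> 0"
    then show ?thesis
      using zw(3) std inj(1) by (intro same) (auto simp: quad_def dest: inj_onD)
  next
    assume "\<not> z $ 1 \<le> 0" "\<not> w $ 1 \<le> 0"
    then show ?thesis
      using zw(3) std inj(2) by (intro same) (auto simp: quad_def dest: inj_onD)
  next
    assume "z $ 1 \<le> 0" "\<not> w $ 1 \<le> 0"
    then show ?thesis
      using zw cross[of z w] by (simp add: quad_def)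
  next
    assume "\<not> z $ 1 \<le> 0" "w $ 1 \<le> 0"
    then show ?thesis
      using zw cross[of w z] by (simp add: quad_def)
  qed
qed

lemma quad_image:
  assumes "hinge S \<sigma> \<tau>"
  shows "quad \<sigma> \<tau> ` diamond = carrier \<sigma> \<union> carrier \<tau>"
proof (intro equalityI subsetI)
  fix p assume "p \<in> quad \<sigma> \<tau> ` diamond"
  then show "p \<in> carrier \<sigma> \<union> carrier \<tau>"
    using fold_coords_std by (auto simp: quad_def)
next
  fix p assume "p \<in> carrier \<sigma> \<union> carrier \<tau>"
  then consider x where "x \<in> std_triangle" "p = \<sigma> x" | x where "x \<in> std_triangle" "p = \<tau> x"
    by blast
  then show "p \<in> quad \<sigma> \<tau> ` diamond"
  proof cases
    case 1
    let ?z = "vector [- x $ 1, x $ 3 - x $ 2] :: real^2"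
    have "?z \<in> diamond" "fold_coords ?z = x"
      using 1(1) by (auto simp: diamond_def std_triangle_3 vec_eq_iff forall_3 fold_coords_nth)
    moreover have "quad \<sigma> \<tau> ?z = \<sigma> (fold_coords ?z)"
      using 1(1) by (simp add: quad_def std_triangle_3)
    ultimately show ?thesis
      using 1(2) by (metis imageI)
  next
    case 2
    let ?z = "vector [x $ 1, x $ 3 - x $ 2] :: real^2"
    have "?z \<in> diamond" "fold_coords ?z = x"
      using 2(1) by (auto simp: diamond_def std_triangle_3 vec_eq_iff forall_3 fold_coords_nth)
    moreover have "quad \<sigma> \<tau> ?z = \<tau> (fold_coords ?z)"
      using calculation 2(1) by (intro quad_pos[OF assms]) (auto simp: std_triangle_3)
    ultimately show ?thesis
      using 2(2) by (metis imageI)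
  qed
qed

lemma quad_permute_23:
  "quad (\<sigma> \<circ> permute (Transposition.transpose 2 3)) (\<tau> \<circ> permute (Transposition.transpose 2 3))
    z = quad \<sigma> \<tau> (vector [z $ 1, - z $ 2])"
proof -
  have "permute (Transposition.transpose 2 3) (fold_coords z) = fold_coords (vector [z $ 1, - z $ 2])"
    by (simp add: vec_eq_iff forall_3 fold_coords_nth)
  then show ?thesis
    by (simp add: quad_def)
qed

section \<open>An edge lies in at most two triangles\<close>

text \<open>In a chart, the open diamond becomes an injectively and continuously embedded piece of the plane.
By invariance of domain it is open in the plane, hence open in the image of the chart,
whether or not that image touches the boundary of the half-plane.\<close>

lemma hinge_edge_neighbourhood:
  assumes surf: "surface S" and hinge: "hinge S \<sigma> \<tau>"
    and x: "x \<in> face {2, 3}" "x $ 2 > 0" "x $ 3 > 0"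
  obtains N where "openin S N" "\<sigma> x \<in> N" "N \<subseteq> carrier \<sigma> \<union> carrier \<tau>"
proof -
  let ?Q = "quad \<sigma> \<tau>"
  define D where "D = {z :: real^2. \<bar>z $ 1\<bar> + \<bar>z $ 2\<bar> < 1}"
  have D: "D \<subseteq> diamond" "open D"
    unfolding D_def diamond_def by (auto intro!: open_Collect_less continuous_intros)
  let ?z = "vector [0, x $ 3 - x $ 2] :: real^2"
  have "fold_coords ?z = x" "?z \<in> D"
    using x by (auto simp: D_def face_23 std_triangle_3 vec_eq_iff forall_3 fold_coords_nth)
  then have z: "?z \<in> D" "?Q ?z = \<sigma> x"
    by (simp_all add: quad_def)
  have cont: "continuous_map (top_of_set diamond) S ?Q"
    using hinge by (rule continuous_quad)
  have "\<sigma> x \<in> topspace S"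
    using cont z D(1)
    by (metis continuous_map_image_subset_topspace image_subset_iff subsetD topspace_euclidean_subtopology)
  then obtain U W where U: "openin S U" "\<sigma> x \<in> U" "subtopology S U homeomorphic_space top_of_set (W :: (real^2) set)"
    using surf unfolding surface_def by meson
  then obtain h k where hk: "homeomorphic_maps (subtopology S U) (top_of_set W) h k"
    by (auto simp: homeomorphic_space_def)
  have top_U: "topspace (subtopology S U) = U"
    using U(1) openin_subset by fastforce
  have h: "continuous_map (subtopology S U) (top_of_set W) h" and inv: "\<And>p. p \<in> U \<Longrightarrow> k (h p) = p"
    using hk top_U by (auto simp: homeomorphic_maps_def)
  define E where "E = {z \<in> D. ?Q z \<in> U}"
  have "openin (top_of_set D) E"
    unfolding E_def using openin_continuous_map_preimage[OF continuous_map_from_subtopology_mono[OF cont D(1)] U(1)]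
    by simp
  then have E: "open E"
    using D(2) openin_open_trans by blast
  have "continuous_map (top_of_set E) (subtopology S U) ?Q"
    using continuous_map_from_subtopology_mono[OF cont, of E] D(1)
    by (auto simp: continuous_map_in_subtopology E_def)
  then have "continuous_map (top_of_set E) (top_of_set W) (h \<circ> ?Q)"
    using h by (rule continuous_map_compose)
  then have hQ: "continuous_on E (h \<circ> ?Q)" "(h \<circ> ?Q) ` E \<subseteq> W"
    by (auto simp: continuous_map_in_subtopology)
  have "inj_on (h \<circ> ?Q) E"
  proof (rule inj_onI)
    fix z w assume zw: "z \<in> E" "w \<in> E" "(h \<circ> ?Q) z = (h \<circ> ?Q) w"
    then have "?Q z = ?Q w"
      using inv by (metis (mono_tags, lifting) E_def comp_apply mem_Collect_eq)
    then show "z = w"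
      using zw inj_onD[OF inj_on_quad[OF hinge]] D(1) by (auto simp: E_def)
  qed
  then have "open ((h \<circ> ?Q) ` E)"
    using invariance_of_domain hQ(1) E by blast
  then have G: "openin (top_of_set W) ((h \<circ> ?Q) ` E)"
    using hQ(2) by (simp add: open_subset)
  define N where "N = {p \<in> U. h p \<in> (h \<circ> ?Q) ` E}"
  have "openin (subtopology S U) N"
    using openin_continuous_map_preimage[OF h G] unfolding top_U N_def .
  then have "openin S N"
    using U(1) openin_trans_full by blast
  moreover have "\<sigma> x \<in> N"
    using U(2) z by (auto simp: N_def E_def image_iff intro!: bexI[of _ ?z])
  moreover have "N \<subseteq> carrier \<sigma> \<union> carrier \<tau>"
  proof
    fix p assume "p \<in> N"
    then obtain w where w: "p \<in> U" "w \<in> E" "h p = h (?Q w)"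
      by (auto simp: N_def)
    then have "p = ?Q w"
      using inv by (metis (mono_tags, lifting) E_def mem_Collect_eq)
    then show "p \<in> carrier \<sigma> \<union> carrier \<tau>"
      using w(2) D(1) by (auto simp: E_def simp flip: quad_image[OF hinge])
  qed
  ultimately show thesis
    by (rule that)
qed

text \<open>The segment from \<open>y\<close> to the centre of the triangle enters the interior at once.\<close>

lemma std_triangle_interior_dense:
  assumes "y \<in> std_triangle" "openin (top_of_set std_triangle) G" "y \<in> G"
  obtains w where "w \<in> G" "\<And>i. w $ i > 0"
proof -
  obtain H where H: "open H" "G = std_triangle \<inter> H"
    using assms(2) by (auto simp: openin_open)
  define \<gamma> where "\<gamma> t = (1 - t) *\<^sub>R y + t *\<^sub>R ((\<chi> i. 1/3) :: real^3)" for t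
  have "((\<lambda>t. \<gamma> t) \<longlongrightarrow> \<gamma> 0) (at_right 0)"
    unfolding \<gamma>_def by (intro tendsto_intros)
  then have "\<forall>\<^sub>F t in at_right 0. \<gamma> t \<in> H"
    using assms(3) H by (intro topological_tendstoD) (auto simp: \<gamma>_def)
  then have "\<forall>\<^sub>F t in at_right 0. \<gamma> t \<in> H \<and> 0 < t \<and> t < 1"
  proof (rule eventually_conj)
    show "\<forall>\<^sub>F t in at_right (0::real). 0 < t \<and> t < 1"
      unfolding eventually_at_right_field using zero_less_one by blast
  qed
  then obtain t where t: "\<gamma> t \<in> H" "0 < t" "t < 1"
    using eventually_happens'[of "at_right (0::real)"] by auto
  have pos: "\<gamma> t $ i > 0" for i
    using t assms(1) by (simp add: \<gamma>_def std_triangle_def add_nonneg_pos)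
  have "(1 - t) * (y $ 1 + y $ 2 + y $ 3) = 1 - t"
    using assms(1) by (simp add: std_triangle_3)
  then have "\<gamma> t $ 1 + \<gamma> t $ 2 + \<gamma> t $ 3 = 1"
    by (simp add: \<gamma>_def algebra_simps)
  then have "\<gamma> t \<in> std_triangle"
    using pos[of 1] pos[of 2] pos[of 3] by (simp add: std_triangle_3)
  then show thesis
    using that[of "\<gamma> t"] pos t H by blast
qed

text \<open>The neighbourhood of the edge point contains interior points of any triangle through it, whereas
proper meeting with \<open>\<sigma>\<close> and \<open>\<tau>\<close> allows boundary points of that triangle only.\<close>

lemma hinge_edge_in_no_third_triangle:
  assumes "surface S" "hinge S \<sigma> \<tau>" "embedded_triangle S \<rho>" "meet_properly \<rho> \<sigma>" "meet_properly \<rho> \<tau>"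
    and x: "x \<in> face {2, 3}" "x $ 2 > 0" "x $ 3 > 0"
  shows "\<sigma> x \<notin> carrier \<rho>"
proof
  assume "\<sigma> x \<in> carrier \<rho>"
  then obtain y where y: "y \<in> std_triangle" "\<rho> y = \<sigma> x"
    by force
  obtain N where N: "openin S N" "\<sigma> x \<in> N" "N \<subseteq> carrier \<sigma> \<union> carrier \<tau>"
    using hinge_edge_neighbourhood[OF assms(1,2) x] .
  have \<rho>: "continuous_map (top_of_set std_triangle) S \<rho>" "inj_on \<rho> std_triangle"
    using assms(3) by (auto simp: embedded_triangle_def)
  obtain w where w: "w \<in> {w \<in> std_triangle. \<rho> w \<in> N}" "\<And>i. w $ i > 0"
    using std_triangle_interior_dense[OF y(1), of "{w \<in> std_triangle. \<rho> w \<in> N}"]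
      openin_continuous_map_preimage[OF \<rho>(1) N(1)] y N(2) by auto
  then consider "\<rho> w \<in> carrier \<rho> \<inter> carrier \<sigma>" | "\<rho> w \<in> carrier \<rho> \<inter> carrier \<tau>"
    using N(3) by blast
  then have "glued \<rho> \<sigma> (\<rho> w) \<or> glued \<rho> \<tau> (\<rho> w)"
    using assms(4,5) unfolding meet_properly_def by metis
  then have "\<exists>i. w $ i = 0"
    using glued_zero_coordinate[OF _ \<rho>(2)] w(1) by blast
  then show False
    using w(2) by (metis less_irrefl)
qed

section \<open>Cutting the quadrilateral along its other diagonal\<close>

text \<open>The triangle \<open>abc\<close>, as the image of the lower half of the diamond.  The argument of \<open>quad\<close> is the
affine map that sends the three corners to \<open>(-1, 0)\<close>, \<open>(0, -1)\<close>, \<open>(1, 0)\<close>.\<close>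

definition half :: "(real^3 \<Rightarrow> 'a) \<Rightarrow> (real^3 \<Rightarrow> 'a) \<Rightarrow> real^3 \<Rightarrow> 'a" where
  "half \<sigma> \<tau> x = quad \<sigma> \<tau> (vector [x $ 3 - x $ 1, - x $ 2])"

text \<open>The triangle \<open>adc\<close>: the construction of \<open>abc\<close> with \<open>b\<close> and \<open>d\<close> exchanged, which reflects the diamond in
its horizontal diagonal (\<open>other_half_eq\<close>).\<close>

definition other_half :: "(real^3 \<Rightarrow> 'a) \<Rightarrow> (real^3 \<Rightarrow> 'a) \<Rightarrow> real^3 \<Rightarrow> 'a" where
  "other_half \<sigma> \<tau> = half (\<sigma> \<circ> permute (Transposition.transpose 2 3)) (\<tau> \<circ> permute (Transposition.transpose 2 3))"

lemma other_half_eq: "other_half \<sigma> \<tau> x = quad \<sigma> \<tau> (vector [x $ 3 - x $ 1, x $ 2])"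
  by (simp add: other_half_def half_def quad_permute_23)

lemma half_in_diamond:
  "x \<in> std_triangle \<Longrightarrow> \<bar>s\<bar> = x $ 2 \<Longrightarrow> vector [x $ 3 - x $ 1, s] \<in> diamond"
  by (auto simp: diamond_def std_triangle_3)

lemma half_left:
  assumes "x \<in> std_triangle" "x $ 3 \<le> x $ 1"
  shows "half \<sigma> \<tau> x = \<sigma> (vector [x $ 1 - x $ 3, x $ 2 + x $ 3, x $ 3])"
proof -
  have "fold_coords (vector [x $ 3 - x $ 1, - x $ 2]) = vector [x $ 1 - x $ 3, x $ 2 + x $ 3, x $ 3]"
    using assms by (auto simp: vec_eq_iff forall_3 fold_coords_nth std_triangle_3)
  then show ?thesis
    using assms(2) by (simp add: half_def quad_def)
qed

lemma half_right:
  assumes "hinge S \<sigma> \<tau>" "x \<in> std_triangle" "x $ 1 \<le> x $ 3"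
  shows "half \<sigma> \<tau> x = \<tau> (vector [x $ 3 - x $ 1, x $ 2 + x $ 1, x $ 1])"
proof -
  have "fold_coords (vector [x $ 3 - x $ 1, - x $ 2]) = vector [x $ 3 - x $ 1, x $ 2 + x $ 1, x $ 1]"
    using assms by (auto simp: vec_eq_iff forall_3 fold_coords_nth std_triangle_3)
  moreover have "half \<sigma> \<tau> x = \<tau> (fold_coords (vector [x $ 3 - x $ 1, - x $ 2]))"
    unfolding half_def using assms
    by (intro quad_pos half_in_diamond) (auto simp: std_triangle_3)
  ultimately show ?thesis
    by simp
qed

text \<open>Exchanging \<open>a\<close> and \<open>c\<close> reflects the diamond in its vertical diagonal, so that statements about the
part of \<open>abc\<close> in \<open>\<tau>\<close> follow from those about the part in \<open>\<sigma>\<close>.\<close>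

lemma half_flip:
  assumes "hinge S \<sigma> \<tau>" "x \<in> std_triangle"
  shows "half \<sigma> \<tau> x = (half \<tau> \<sigma> \<circ> permute (Transposition.transpose 1 3)) x"
proof -
  let ?y = "permute (Transposition.transpose 1 3) x"
  have y: "?y \<in> std_triangle" "?y $ 1 = x $ 3" "?y $ 2 = x $ 2" "?y $ 3 = x $ 1"
    using permute_std[OF bij_transpose assms(2)] by simp_all
  show ?thesis
  proof (cases "x $ 3 \<le> x $ 1")
    case True
    then show ?thesis
      using half_left[OF assms(2)] half_right[OF hinge_sym[OF assms(1)] y(1)] y by simp
  next
    case False
    then show ?thesis
      using half_right[OF assms] half_left[OF y(1), of \<tau> \<sigma>] y by simp
  qed
qed

lemma embedded_half:
  assumes "hinge S \<sigma> \<tau>"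
  shows "embedded_triangle S (half \<sigma> \<tau>)"
proof -
  let ?g = "\<lambda>x. vector [x $ 3 - x $ 1, - x $ 2] :: real^2"
  have half: "half \<sigma> \<tau> = quad \<sigma> \<tau> \<circ> ?g"
    by (auto simp: half_def)
  have into: "?g x \<in> diamond" if "x \<in> std_triangle" for x
    using that by (intro half_in_diamond) (auto simp: std_triangle_3)
  have "continuous_on std_triangle (\<lambda>x. \<chi> i. ?g x $ i)"
  proof (rule continuous_on_vec_lambda)
    fix i :: 2
    show "continuous_on std_triangle (\<lambda>x. ?g x $ i)"
      using exhaust_2[of i] by (elim disjE; hypsubst; simp) (auto intro!: continuous_intros)
  qed
  then have "continuous_map (top_of_set std_triangle) (top_of_set diamond) ?g"
    using into by auto
  then have "continuous_map (top_of_set std_triangle) S (half \<sigma> \<tau>)"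
    unfolding half using continuous_quad[OF assms] by (rule continuous_map_compose)
  moreover have "inj_on (half \<sigma> \<tau>) std_triangle"
    unfolding half
  proof (rule comp_inj_on)
    show "inj_on ?g std_triangle"
      by (rule inj_onI) (auto simp: std_triangle_3 vec_eq_iff forall_2 forall_3)
    show "inj_on (quad \<sigma> \<tau>) (?g ` std_triangle)"
      using inj_on_quad[OF assms] by (rule inj_on_subset) (auto intro: into)
  qed
  ultimately show ?thesis
    by (simp add: embedded_triangle_def)
qed

lemma embedded_other_half: "hinge S \<sigma> \<tau> \<Longrightarrow> embedded_triangle S (other_half \<sigma> \<tau>)"
  unfolding other_half_def by (intro embedded_half hinge_permute_23)

lemma corners_eq: "corners \<sigma> = {\<sigma> (corner 1), \<sigma> (corner 2), \<sigma> (corner 3)}"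
  by (simp add: UNIV_3)

lemma vector_corner:
  "vector [1, 0, 0] = corner 1" "vector [0, 1, 0] = corner 2" "vector [0, 0, 1] = corner 3"
  by (simp_all add: vec_eq_iff forall_3 corner_nth)

lemma corners_half:
  assumes "hinge S \<sigma> \<tau>"
  shows "corners (half \<sigma> \<tau>) = {\<sigma> (corner 1), \<sigma> (corner 2), \<tau> (corner 1)}"
  using half_left[OF corner_in_std, of 1 \<sigma> \<tau>] half_left[OF corner_in_std, of 2 \<sigma> \<tau>]
    half_right[OF assms corner_in_std, of 3]
  by (simp add: corners_eq corner_nth vector_corner)

lemma corners_other_half:
  assumes "hinge S \<sigma> \<tau>"
  shows "corners (other_half \<sigma> \<tau>) = {\<sigma> (corner 1), \<sigma> (corner 3), \<tau> (corner 1)}"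
proof -
  have "permute (Transposition.transpose 2 3) (corner 1) = corner 1"
    "permute (Transposition.transpose 2 3) (corner 2) = corner 3"
    by (simp_all add: vec_eq_iff forall_3 corner_nth)
  then show ?thesis
    using corners_half[OF hinge_permute_23[OF assms]] by (simp add: other_half_def)
qed

lemma carrier_halves:
  assumes "hinge S \<sigma> \<tau>"
  shows "carrier (half \<sigma> \<tau>) \<union> carrier (other_half \<sigma> \<tau>) = carrier \<sigma> \<union> carrier \<tau>"
proof -
  have "carrier (half \<sigma> \<tau>) \<union> carrier (other_half \<sigma> \<tau>) = quad \<sigma> \<tau> ` diamond"
  proof (intro equalityI subsetI)
    fix p assume "p \<in> carrier (half \<sigma> \<tau>) \<union> carrier (other_half \<sigma> \<tau>)"
    then show "p \<in> quad \<sigma> \<tau> ` diamond"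
      by (auto simp: half_def other_half_eq std_triangle_3 intro!: imageI half_in_diamond)
  next
    fix p assume "p \<in> quad \<sigma> \<tau> ` diamond"
    then obtain z where z: "z \<in> diamond" "p = quad \<sigma> \<tau> z"
      by blast
    \<comment> \<open>the horizontal segment of the diamond at the height of z has half-length ?t\<close>
    let ?t = "1 - \<bar>z $ 2\<bar>"
    let ?x = "vector [(?t - z $ 1) / 2, \<bar>z $ 2\<bar>, (?t + z $ 1) / 2] :: real^3"
    have x: "?x \<in> std_triangle" "?x $ 3 - ?x $ 1 = z $ 1" "?x $ 2 = \<bar>z $ 2\<bar>"
      using z(1) by (auto simp: std_triangle_3 diamond_def field_simps)
    have eta: "vector [z $ 1, z $ 2] = z"
      by (simp add: vec_eq_iff forall_2)
    have "half \<sigma> \<tau> ?x = p \<or> other_half \<sigma> \<tau> ?x = p"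
      unfolding half_def other_half_eq x(2,3) z(2) by (cases "z $ 2 \<ge> 0") (simp_all add: eta)
    then show "p \<in> carrier (half \<sigma> \<tau>) \<union> carrier (other_half \<sigma> \<tau>)"
      using x(1) by blast
  qed
  then show ?thesis
    by (simp add: quad_image[OF assms])
qed

text \<open>Common points of the lower and the upper half of the diamond lie on the horizontal diagonal, where
the two parametrizations coincide.\<close>

lemma halves_meet_properly:
  assumes "hinge S \<sigma> \<tau>"
  shows "meet_properly (half \<sigma> \<tau>) (other_half \<sigma> \<tau>)"
  unfolding meet_properly_def
proof
  fix p assume "p \<in> carrier (half \<sigma> \<tau>) \<inter> carrier (other_half \<sigma> \<tau>)"
  then obtain x y where xy: "x \<in> std_triangle" "y \<in> std_triangle" "p = half \<sigma> \<tau> x" "p = other_half \<sigma> \<tau> y"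
    by blast
  then have "quad \<sigma> \<tau> (vector [x $ 3 - x $ 1, - x $ 2]) = quad \<sigma> \<tau> (vector [y $ 3 - y $ 1, y $ 2])"
    by (simp add: half_def other_half_eq)
  then have "vector [x $ 3 - x $ 1, - x $ 2] = (vector [y $ 3 - y $ 1, y $ 2] :: real^2)"
    using xy(1,2) by (intro inj_onD[OF inj_on_quad[OF assms]] half_in_diamond) (auto simp: std_triangle_3)
  then have "x $ 2 = 0"
    using xy(1,2) by (auto simp: vec_eq_iff forall_2 std_triangle_3)
  then have "x \<in> face {1, 3}"
    using xy(1) by (auto simp: face_def forall_3)
  moreover have "half \<sigma> \<tau> z = other_half \<sigma> \<tau> (permute id z)" if "z \<in> face {1, 3}" for z
    using that by (auto simp: half_def other_half_eq face_def forall_3)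
  moreover have "2 \<notin> {1, 3 :: 3}"
    by simp
  then have "{1, 3 :: 3} \<noteq> UNIV"
    by blast
  ultimately show "glued (half \<sigma> \<tau>) (other_half \<sigma> \<tau>) p"
    unfolding xy(3) by (intro gluedI[OF _ bij_id])
qed

text \<open>Where \<open>abc\<close> runs along the boundary of \<open>\<sigma>\<close>, away from the edge \<open>bd\<close>, it runs along \<open>ab\<close>.  There it is
parametrized just like \<open>\<sigma>\<close>, so it is glued to \<open>\<sigma>\<close>, and by transitivity to \<open>\<rho>\<close>.\<close>

lemma glued_half_left:
  assumes hinge: "hinge S \<sigma> \<tau>" and meet: "meet_properly \<sigma> \<rho>"
    and edge: "\<And>x. x \<in> face {2, 3} \<Longrightarrow> x $ 2 > 0 \<Longrightarrow> x $ 3 > 0 \<Longrightarrow> \<sigma> x \<notin> carrier \<rho>"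
    and x: "x \<in> std_triangle" "half \<sigma> \<tau> x \<in> carrier \<rho>" "x $ 3 \<le> x $ 1"
  shows "glued (half \<sigma> \<tau>) \<rho> (half \<sigma> \<tau> x)"
proof -
  let ?v = "vector [x $ 1 - x $ 3, x $ 2 + x $ 3, x $ 3] :: real^3"
  have v: "?v \<in> std_triangle" "half \<sigma> \<tau> x = \<sigma> ?v"
    using x(1,3) half_left[OF x(1,3)] by (auto simp: std_triangle_3)
  have "glued \<sigma> \<rho> (\<sigma> ?v)"
    using meet v x(2) unfolding meet_properly_def by auto
  moreover have inj: "inj_on \<sigma> std_triangle"
    using hinge by (simp add: hinge_def embedded_triangle_def)
  ultimately obtain i where i: "?v $ i = 0"
    using glued_zero_coordinate v(1) by blast
  have "x $ 3 = 0"
  proof (rule ccontr)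
    assume "x $ 3 \<noteq> 0"
    then have "x $ 3 > 0" "?v $ 1 = 0"
      using x(1) i exhaust_3[of i] by (auto simp: std_triangle_3)
    then have "\<sigma> ?v \<notin> carrier \<rho>"
      using v(1) x(1) by (intro edge) (auto simp: face_23 std_triangle_3)
    then show False
      using x(2) v(2) by simp
  qed
  then have "x \<in> face {1, 2}"
    using x(1) by (auto simp: face_def forall_3)
  moreover have "half \<sigma> \<tau> z = \<sigma> (permute id z)" if "z \<in> face {1, 2}" for z
  proof -
    have z: "z \<in> std_triangle" "z $ 3 = 0"
      using that by (auto simp: face_def forall_3)
    then have "vector [z $ 1 - z $ 3, z $ 2 + z $ 3, z $ 3] = permute id z"
      by (simp add: vec_eq_iff forall_3)
    then show ?thesis
      using z half_left[OF z(1), of \<sigma> \<tau>] by (simp add: std_triangle_3)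
  qed
  moreover have "3 \<notin> {1, 2 :: 3}"
    by simp
  then have "{1, 2 :: 3} \<noteq> UNIV"
    by blast
  ultimately have "glued (half \<sigma> \<tau>) \<sigma> (half \<sigma> \<tau> x)"
    by (intro gluedI[OF _ bij_id])
  then show ?thesis
    using \<open>glued \<sigma> \<rho> (\<sigma> ?v)\<close> inj unfolding v(2) by (rule glued_trans)
qed

lemma glued_cong:
  assumes "glued \<sigma> \<rho> p" "\<And>x. x \<in> std_triangle \<Longrightarrow> \<sigma> x = \<sigma>' x"
  shows "glued \<sigma>' \<rho> p"
proof -
  have "\<sigma> x = \<sigma>' x" if "x \<in> face I" for x I
    using assms(2) that face_subset by blast
  then show ?thesis
    using assms(1) unfolding glued_def by (metis image_cong)
qed

text \<open>The part of \<open>abc\<close> in \<open>\<sigma>\<close> is covered by \<open>glued_half_left\<close>, and the part in \<open>\<tau>\<close> by the same lemma for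
the reflected hinge.\<close>

lemma half_meets_properly:
  assumes hinge: "hinge S \<sigma> \<tau>" and meet: "meet_properly \<sigma> \<rho>" "meet_properly \<tau> \<rho>"
    and edge: "\<And>x. x \<in> face {2, 3} \<Longrightarrow> x $ 2 > 0 \<Longrightarrow> x $ 3 > 0 \<Longrightarrow> \<sigma> x \<notin> carrier \<rho>"
  shows "meet_properly (half \<sigma> \<tau>) \<rho>"
  unfolding meet_properly_def
proof
  fix p assume "p \<in> carrier (half \<sigma> \<tau>) \<inter> carrier \<rho>"
  then obtain x where x: "x \<in> std_triangle" "p = half \<sigma> \<tau> x" "p \<in> carrier \<rho>"
    by blast
  show "glued (half \<sigma> \<tau>) \<rho> p"
  proof (cases "x $ 3 \<le> x $ 1")
    case True
    then show ?thesis
      using glued_half_left[OF hinge meet(1) edge] x by blast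
  next
    case False
    let ?s = "Transposition.transpose 1 3 :: 3 \<Rightarrow> 3"
    let ?y = "permute ?s x"
    have y: "?y \<in> std_triangle" "half \<tau> \<sigma> ?y = p" "?y $ 3 \<le> ?y $ 1"
      using False permute_std[OF bij_transpose x(1)] half_flip[OF hinge x(1)] x(2) by simp_all
    have "\<tau> z = \<sigma> z" if "z \<in> face {2, 3}" for z
      using hinge that by (simp add: hinge_def)
    then have "glued (half \<tau> \<sigma>) \<rho> (half \<tau> \<sigma> ?y)"
      using edge y x(3) by (intro glued_half_left[OF hinge_sym[OF hinge] meet(2)]) auto
    then have "glued (half \<tau> \<sigma> \<circ> permute ?s) \<rho> p"
      unfolding y(2) by (rule glued_permute) (rule bij_transpose)
    then show ?thesis
      by (rule glued_cong) (simp add: half_flip[OF hinge])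
  qed
qed

lemma other_half_meets_properly:
  assumes hinge: "hinge S \<sigma> \<tau>" and meet: "meet_properly \<sigma> \<rho>" "meet_properly \<tau> \<rho>"
    and edge: "\<And>x. x \<in> face {2, 3} \<Longrightarrow> x $ 2 > 0 \<Longrightarrow> x $ 3 > 0 \<Longrightarrow> \<sigma> x \<notin> carrier \<rho>"
  shows "meet_properly (other_half \<sigma> \<tau>) \<rho>"
  unfolding other_half_def
proof (rule half_meets_properly)
  fix x assume x: "x \<in> face {2, 3}" "x $ 2 > 0" "x $ 3 > 0"
  then show "(\<sigma> \<circ> permute (Transposition.transpose 2 3)) x \<notin> carrier \<rho>"
    using edge[of "permute (Transposition.transpose 2 3) x"] permute_std[OF bij_transpose]
    by (simp add: face_23)
qed (use assms in \<open>auto intro: hinge_permute_23 meet_properly_permute bij_transpose\<close>)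

section \<open>Flips of triangulations\<close>

text \<open>The gluing at the midpoint \<open>m\<close> of the common edge extends over the whole edge, because no smaller face
contains \<open>m\<close>.  So two set-theoretically equal edges are already identified by an affine map, and
permuting coordinates brings the pair into the normal form.\<close>

lemma hinge_of_common_edge:
  assumes emb: "embedded_triangle S \<sigma>" "embedded_triangle S \<tau>" and meet: "meet_properly \<sigma> \<tau>"
    and ikl: "{i, k, l} = UNIV" and edge: "\<sigma> ` face (- {i}) = \<tau> ` face (- {j})"
    and apex: "\<sigma> (corner i) \<noteq> \<tau> (corner j)"
  obtains \<pi> \<kappa> where "bij \<pi>" "bij \<kappa>" "hinge S (\<sigma> \<circ> permute \<pi>) (\<tau> \<circ> permute \<kappa>)"
    "permute \<pi> (corner 1) = corner i" "permute \<pi> (corner 2) = corner k" "permute \<pi> (corner 3) = corner l"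
    "permute \<kappa> (corner 1) = corner j"
proof -
  have dist: "i \<noteq> k" "i \<noteq> l" "k \<noteq> l"
  proof -
    have "card {i, k, l} = 3"
      unfolding ikl by simp
    then show "i \<noteq> k" "i \<noteq> l" "k \<noteq> l"
      by (auto simp: card_insert_if split: if_splits)
  qed
  have cases: "m = i \<or> m = k \<or> m = l" for m
    using ikl by auto
  have inj: "inj_on \<sigma> std_triangle" "inj_on \<tau> std_triangle"
    using emb by (auto simp: embedded_triangle_def)
  \<comment> \<open>the midpoint of the common edge\<close>
  define m :: "real^3" where "m = (\<chi> n. if n = i then 0 else 1/2)"
  have "(\<Sum>n\<in>UNIV. m $ n) = (\<Sum>n\<in>{i, k, l}. m $ n)"
    by (simp only: ikl)
  then have m: "m \<in> face (- {i})" "m \<in> std_triangle"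
    using dist by (auto simp: face_def std_triangle_def m_def)
  have "\<sigma> m \<in> \<tau> ` face (- {j})"
    using edge m(1) by blast
  then obtain y where y: "y \<in> face (- {j})" "\<sigma> m = \<tau> y"
    by blast
  have "\<sigma> m \<in> carrier \<sigma> \<inter> carrier \<tau>"
    using m(2) y face_subset by blast
  then have "glued \<sigma> \<tau> (\<sigma> m)"
    using meet by (simp only: meet_properly_def)
  then obtain I \<mu> z where I: "I \<noteq> UNIV" "bij \<mu>" "z \<in> face I" "\<sigma> m = \<sigma> z"
      "\<And>x. x \<in> face I \<Longrightarrow> \<sigma> x = \<tau> (permute \<mu> x)"
    by (rule gluedE) (rule that)
  have mz: "m = z"
    using inj_onD[OF inj(1) I(4) m(2)] I(3) face_subset by blast
  have others: "n \<in> I" if "n \<noteq> i" for n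
    using I(3) that unfolding mz[symmetric] by (auto simp: face_def m_def)
  then have "i \<notin> I"
    using I(1) by (metis UNIV_eq_I)
  then have I_eq: "I = - {i}"
    using others by blast
  have "\<tau> y = \<tau> (permute \<mu> m)"
    using y(2) I(5)[of m] I(3) mz by simp
  then have "y = permute \<mu> m"
    using inj_onD[OF inj(2)] y(1) face_subset permute_std[OF I(2) m(2)] by blast
  then have "m $ \<mu> j = 0"
    using y(1) by (auto simp: face_def)
  then have \<mu>j: "\<mu> j = i"
    by (simp add: m_def split: if_splits)
  define \<pi> :: "3 \<Rightarrow> 3" where "\<pi> n = (if n = i then 1 else if n = k then 2 else 3)" for n
  have \<pi>_nth: "\<pi> i = 1" "\<pi> k = 2" "\<pi> l = 3"
    using dist by (auto simp: \<pi>_def)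
  have "surj \<pi>"
    by (metis UNIV_I \<pi>_nth exhaust_3 surjI surj_def)
  then have \<pi>: "bij \<pi>"
    by (simp add: bij_def finite_UNIV_surj_inj)
  define \<kappa> where "\<kappa> = \<pi> \<circ> \<mu>"
  have \<kappa>: "bij \<kappa>" "permute \<kappa> x = permute \<mu> (permute \<pi> x)" "\<kappa> j = 1" for x
    using \<pi> I(2) \<mu>j \<pi>_nth by (auto simp: \<kappa>_def bij_comp permute_compose)
  have corner: "permute \<pi> (corner 1) = corner i" "permute \<pi> (corner 2) = corner k"
      "permute \<pi> (corner 3) = corner l" "permute \<kappa> (corner 1) = corner j"
    using permute_corner[OF \<pi>, of i] permute_corner[OF \<pi>, of k] permute_corner[OF \<pi>, of l]
      permute_corner[OF \<kappa>(1), of j] by (simp_all add: \<pi>_nth \<kappa>)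
  have "meet_properly (\<sigma> \<circ> permute \<pi>) (\<tau> \<circ> permute \<kappa>)"
    using meet \<pi> \<kappa>(1) by (meson meet_properly_permute meet_properly_sym)
  moreover have "\<sigma> (permute \<pi> x) = \<tau> (permute \<kappa> x)" if "x \<in> face {2, 3}" for x
  proof -
    have "permute \<pi> x \<in> face I"
      using that permute_std[OF \<pi>] by (simp add: I_eq face_23 face_def \<pi>_nth)
    then show ?thesis
      by (simp add: I(5) \<kappa>(2))
  qed
  ultimately have "hinge S (\<sigma> \<circ> permute \<pi>) (\<tau> \<circ> permute \<kappa>)"
    using apex emb \<pi> \<kappa>(1) by (simp add: hinge_def embedded_permute corner)
  then show thesis
    using that \<pi> \<kappa>(1) corner by blast
qed

text \<open>A flip replaces the two triangles \<open>\<sigma>\<close> and \<open>\<tau>\<close> at an edge by the halves of their quadrilateral.  The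
last conclusion describes its effect on every additive quantity that depends only on the corners of
the triangles.\<close>

lemma flip_edge:
  fixes S :: "'a topology"
  assumes surf: "surface S" and tri: "surface_triangulation S T V"
    and st: "\<sigma> \<in> T" "\<tau> \<in> T" "\<sigma> \<noteq> \<tau>"
    and ikl: "{i, k, l} = UNIV" and edge: "\<sigma> ` face (- {i}) = \<tau> ` face (- {j})"
    and apex: "\<sigma> (corner i) \<noteq> \<tau> (corner j)"
  defines "a \<equiv> \<sigma> (corner i)" and "b \<equiv> \<sigma> (corner k)" and "c \<equiv> \<tau> (corner j)" and "d \<equiv> \<sigma> (corner l)"
  obtains T' where "surface_triangulation S T' V" "card T' = card T" "card {a, b, c, d} = 4"
    "\<And>w :: 'a set \<Rightarrow> real. (\<Sum>\<rho>\<in>T'. w (corners \<rho>)) + w {a, b, d} + w {b, c, d}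
      = (\<Sum>\<rho>\<in>T. w (corners \<rho>)) + w {a, b, c} + w {a, c, d}"
proof -
  have T: "finite T" "\<And>\<sigma>. \<sigma> \<in> T \<Longrightarrow> embedded_triangle S \<sigma>" "topspace S = (\<Union>\<sigma>\<in>T. carrier \<sigma>)"
      "V = (\<Union>\<sigma>\<in>T. corners \<sigma>)" "\<And>\<sigma> \<tau>. \<sigma> \<in> T \<Longrightarrow> \<tau> \<in> T \<Longrightarrow> \<sigma> \<noteq> \<tau> \<Longrightarrow> meet_properly \<sigma> \<tau>"
    using tri by (auto simp: surface_triangulation_iff pairwise_def)
  obtain \<pi> \<kappa> where perm: "bij \<pi>" "bij \<kappa>" and hinge: "hinge S (\<sigma> \<circ> permute \<pi>) (\<tau> \<circ> permute \<kappa>)"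
    and corner: "permute \<pi> (corner 1) = corner i" "permute \<pi> (corner 2) = corner k"
      "permute \<pi> (corner 3) = corner l" "permute \<kappa> (corner 1) = corner j"
    using hinge_of_common_edge[OF T(2)[OF st(1)] T(2)[OF st(2)] T(5)[OF st] ikl edge apex] .
  define \<sigma>' \<tau>' where "\<sigma>' = \<sigma> \<circ> permute \<pi>" and "\<tau>' = \<tau> \<circ> permute \<kappa>"
  note hinge = hinge[folded \<sigma>'_def \<tau>'_def]
  have \<sigma>': "carrier \<sigma>' = carrier \<sigma>" "corners \<sigma>' = corners \<sigma>" "\<sigma>' (corner 1) = a" "\<sigma>' (corner 2) = b"
      "\<sigma>' (corner 3) = d"
    unfolding \<sigma>'_def using carrier_permute[OF perm(1)] corners_permute[OF perm(1)]
    by (simp_all add: corner a_def b_def d_def)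
  have \<tau>': "carrier \<tau>' = carrier \<tau>" "corners \<tau>' = corners \<tau>" "\<tau>' (corner 1) = c"
    unfolding \<tau>'_def using carrier_permute[OF perm(2)] corners_permute[OF perm(2)]
    by (simp_all add: corner c_def)
  have "\<sigma>' x = \<tau>' x" if "x \<in> face {2, 3}" for x
    using hinge that by (simp add: hinge_def)
  then have \<tau>'_bd: "\<tau>' (corner 2) = b" "\<tau>' (corner 3) = d"
    using \<sigma>' by (simp_all add: corner_in_face_iff flip: \<sigma>'(4,5))
  have corners_old: "corners \<sigma> = {a, b, d}" "corners \<tau> = {b, c, d}"
    using corners_eq[of \<sigma>'] corners_eq[of \<tau>'] unfolding \<sigma>' \<tau>' \<tau>'_bd
    by (simp_all only: insert_commute[of b c])
  define N N' where "N = half \<sigma>' \<tau>'" and "N' = other_half \<sigma>' \<tau>'"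
  have corners_new: "corners N = {a, b, c}" "corners N' = {a, c, d}"
    using corners_half[OF hinge] corners_other_half[OF hinge] \<sigma>' \<tau>' by (auto simp: N_def N'_def)
  have emb: "embedded_triangle S N" "embedded_triangle S N'"
    unfolding N_def N'_def using hinge by (auto intro: embedded_half embedded_other_half)
  define R where "R = T - {\<sigma>, \<tau>}"
  have rest: "meet_properly N \<rho>" "meet_properly N' \<rho>" if "\<rho> \<in> R" for \<rho>
  proof -
    have \<rho>: "\<rho> \<in> T" "\<rho> \<noteq> \<sigma>" "\<rho> \<noteq> \<tau>"
      using that by (auto simp: R_def)
    then have meet: "meet_properly \<sigma>' \<rho>" "meet_properly \<tau>' \<rho>"
      using T(5) st perm by (auto simp: \<sigma>'_def \<tau>'_def intro: meet_properly_permute)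
    have "\<sigma>' x \<notin> carrier \<rho>" if "x \<in> face {2, 3}" "x $ 2 > 0" "x $ 3 > 0" for x
      using surf hinge T(2)[OF \<rho>(1)] meet[THEN meet_properly_sym] that
      by (rule hinge_edge_in_no_third_triangle)
    then show "meet_properly N \<rho>" "meet_properly N' \<rho>"
      unfolding N_def N'_def using hinge meet half_meets_properly other_half_meets_properly by metis+
  qed
  have NN': "meet_properly N N'"
    unfolding N_def N'_def using hinge by (rule halves_meet_properly)
  have inj: "inj_on N std_triangle" "inj_on N' std_triangle"
    using emb by (auto simp: embedded_triangle_def)
  have new: "N \<noteq> N'" "N \<notin> R" "N' \<notin> R"
    using carrier_neq_if_meet_properly[OF _ inj(1)] carrier_neq_if_meet_properly[OF _ inj(2)]
      NN' rest by metis+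
  have T_eq: "T = insert \<sigma> (insert \<tau> R)" "\<sigma> \<notin> insert \<tau> R" "\<tau> \<notin> R" "finite R"
    using st T(1) by (auto simp: R_def)
  let ?T' = "insert N (insert N' R)"
  have "carrier N \<union> carrier N' = carrier \<sigma> \<union> carrier \<tau>"
    using carrier_halves[OF hinge] \<sigma>' \<tau>' by (simp add: N_def N'_def)
  then have "topspace S = (\<Union>\<rho>\<in>?T'. carrier \<rho>)"
    unfolding T(3) T_eq(1) by auto
  moreover have "V = (\<Union>\<rho>\<in>?T'. corners \<rho>)"
    unfolding T(4) T_eq(1) using corners_old corners_new by auto
  moreover have "pairwise meet_properly R"
    using T(5) by (auto simp: pairwise_def R_def)
  then have "pairwise meet_properly ?T'"
    using rest NN' by (auto simp: pairwise_insert intro: meet_properly_sym)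
  moreover have "\<forall>\<rho>\<in>?T'. embedded_triangle S \<rho>"
    using emb T(2) by (auto simp: R_def)
  ultimately have "surface_triangulation S ?T' V"
    using T_eq(4) by (simp add: surface_triangulation_iff)
  moreover have "card ?T' = card T"
    using T_eq new by simp
  moreover have "card {a, b, c, d} = 4"
  proof -
    have "card (corners \<rho>) = 3" if "embedded_triangle S \<rho>" for \<rho> :: "real^3 \<Rightarrow> 'a"
    proof -
      have "inj corner"
        by (rule injI) (metis corner_nth zero_neq_one)
      then have "inj_on \<rho> (range corner)" "card (range corner) = 3"
        using that corner_in_std by (auto simp: embedded_triangle_def card_image intro: inj_on_subset)
      then show ?thesis
        by (simp add: card_image)
    qed
    then have "card {a, b, d} = 3" "card {b, c, d} = 3"
      using T(2) st corners_old by metis+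
    moreover have "a \<noteq> c"
      using apex by (simp add: a_def c_def)
    ultimately show ?thesis
      by (auto simp: card_insert_if split: if_splits)
  qed
  moreover have "(\<Sum>\<rho>\<in>?T'. w (corners \<rho>)) + w {a, b, d} + w {b, c, d}
      = (\<Sum>\<rho>\<in>T. w (corners \<rho>)) + w {a, b, c} + w {a, c, d}" for w :: "'a set \<Rightarrow> real"
    using T_eq new by (simp add: corners_old corners_new del: image_image)
  ultimately show thesis
    by (rule that)
qed

section \<open>Triangulations of minimal area\<close>

text \<open>The total weight depends only on the number of members of each type.\<close>

lemma finite_weight_values:
  fixes W :: "'b set \<Rightarrow> real"
  assumes "finite P" "\<And>T. T \<in> X \<Longrightarrow> finite T \<and> card T = n \<and> (\<forall>\<sigma>\<in>T. type \<sigma> \<subseteq> P)"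
  shows "finite ((\<lambda>T. \<Sum>\<sigma>\<in>T. W (type \<sigma>)) ` X)"
proof (rule finite_subset)
  let ?F = "\<lambda>m. \<Sum>Z\<in>Pow P. real (m Z) * W Z"
  show "finite (?F ` (\<Pi>\<^sub>E Z\<in>Pow P. {..n}))"
    using assms(1) by (intro finite_imageI finite_PiE) auto
  show "(\<lambda>T. \<Sum>\<sigma>\<in>T. W (type \<sigma>)) ` X \<subseteq> ?F ` (\<Pi>\<^sub>E Z\<in>Pow P. {..n})"
  proof
    fix s assume "s \<in> (\<lambda>T. \<Sum>\<sigma>\<in>T. W (type \<sigma>)) ` X"
    then obtain T where T: "T \<in> X" "s = (\<Sum>\<sigma>\<in>T. W (type \<sigma>))"
      by blast
    define m where "m = restrict (\<lambda>Z. card {\<sigma> \<in> T. type \<sigma> = Z}) (Pow P)"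
    have "s = (\<Sum>Z\<in>Pow P. \<Sum>\<sigma>\<in>{\<sigma> \<in> T. type \<sigma> = Z}. W (type \<sigma>))"
      unfolding T(2) using assms T(1) by (intro sum.group[symmetric]) auto
    also have "\<dots> = ?F m"
      by (intro sum.cong) (auto simp: m_def)
    finally have "s = ?F m" .
    moreover have "m \<in> (\<Pi>\<^sub>E Z\<in>Pow P. {..n})"
      using assms(2)[OF T(1)] by (auto simp: m_def intro: card_mono)
    ultimately show "s \<in> ?F ` (\<Pi>\<^sub>E Z\<in>Pow P. {..n})"
      by blast
  qed
qed

text \<open>A triangulation that minimizes the total weight \<open>W\<close> of its image triangles has no edge at which a
flip would decrease it.\<close>

lemma exists_triangulation_without_bad_edges:
  fixes S :: "'a topology" and f :: "'a \<Rightarrow> real^3"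
  assumes "finite P" "surface S" "surface_triangulation S T V" "bij_betw f V P"
    and decreasing: "\<And>A B C D. {A, B, C, D} \<subseteq> P \<Longrightarrow> card {A, B, C, D} = 4 \<Longrightarrow> bad A B C D \<Longrightarrow>
      W {A, B, C} + W {A, C, D} < W {A, B, D} + (W {B, C, D} :: real)"
  obtains T\<^sub>0 f\<^sub>0 where "surface_triangulation S T\<^sub>0 V" "realization S T\<^sub>0 V P f\<^sub>0" "\<forall>v\<in>V. f\<^sub>0 v = f v"
    "\<And>A B C D. adjacent_images T\<^sub>0 f\<^sub>0 A B C D \<Longrightarrow> {A, B, C, D} \<subseteq> P \<and> card {A, B, C, D} = 4 \<and> \<not> bad A B C D"
proof -
  define X where "X = {T'. surface_triangulation S T' V \<and> card T' = card T}"
  define \<Phi> where "\<Phi> T' = (\<Sum>\<sigma>\<in>T'. W (f ` corners \<sigma>))" for T' :: "(real^3 \<Rightarrow> 'a) set"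
  have fV: "f ` V = P" "inj_on f V"
    using assms(4) by (auto simp: bij_betw_def)
  have corners_V: "corners \<sigma> \<subseteq> V" if "surface_triangulation S T' V" "\<sigma> \<in> T'" for \<sigma> T'
    using that by (auto simp: surface_triangulation_iff)
  have "finite (\<Phi> ` X)"
    unfolding \<Phi>_def using assms(1)
  proof (rule finite_weight_values)
    fix T' assume "T' \<in> X"
    then show "finite T' \<and> card T' = card T \<and> (\<forall>\<sigma>\<in>T'. f ` corners \<sigma> \<subseteq> P)"
      using corners_V fV(1) by (auto simp: X_def surface_triangulation_iff)
  qed
  moreover have "\<Phi> ` X \<noteq> {}"
    using assms(3) by (auto simp: X_def)
  ultimately obtain m where m: "m \<in> \<Phi> ` X" "\<not> (\<exists>x\<in>\<Phi> ` X. x < m)"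
    using ex_min_if_finite by blast
  then obtain T\<^sub>0 where T0: "T\<^sub>0 \<in> X" "\<And>T'. T' \<in> X \<Longrightarrow> \<Phi> T\<^sub>0 \<le> \<Phi> T'"
    by (auto simp: not_less)
  then have tri: "surface_triangulation S T\<^sub>0 V"
    by (simp add: X_def)
  obtain f\<^sub>0 where f0: "realization S T\<^sub>0 V P f\<^sub>0" "\<And>v. v \<in> V \<Longrightarrow> f\<^sub>0 v = f v"
    using realization_extends_vertex_map[OF _ tri assms(4)] assms(2) unfolding surface_def by blast
  have "{A, B, C, D} \<subseteq> P \<and> card {A, B, C, D} = 4 \<and> \<not> bad A B C D"
    if adjacent: "adjacent_images T\<^sub>0 f\<^sub>0 A B C D" for A B C D
  proof -
    obtain \<sigma> \<tau> i j k l where adj: "\<sigma> \<in> T\<^sub>0" "\<tau> \<in> T\<^sub>0" "\<sigma> \<noteq> \<tau>" "{i, k, l} = UNIV"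
        "\<sigma> ` face (- {i}) = \<tau> ` face (- {j})" "A = f\<^sub>0 (\<sigma> (corner i))" "C = f\<^sub>0 (\<tau> (corner j))" "A \<noteq> C"
        "B = f\<^sub>0 (\<sigma> (corner k))" "D = f\<^sub>0 (\<sigma> (corner l))"
      using adjacent unfolding adjacent_images_def by blast
    let ?a = "\<sigma> (corner i)" and ?b = "\<sigma> (corner k)" and ?c = "\<tau> (corner j)" and ?d = "\<sigma> (corner l)"
    have V: "{?a, ?b, ?c, ?d} \<subseteq> V"
      using corners_V[OF tri adj(1)] corners_V[OF tri adj(2)] by blast
    then have img: "A = f ?a" "B = f ?b" "C = f ?c" "D = f ?d"
      using adj f0(2) by auto
    have "?a \<noteq> ?c"
      using adj by metis
    then obtain T' where T': "surface_triangulation S T' V" "card T' = card T\<^sub>0" "card {?a, ?b, ?c, ?d} = 4"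
      "\<And>w :: 'a set \<Rightarrow> real. (\<Sum>\<rho>\<in>T'. w (corners \<rho>)) + w {?a, ?b, ?d} + w {?b, ?c, ?d}
        = (\<Sum>\<rho>\<in>T\<^sub>0. w (corners \<rho>)) + w {?a, ?b, ?c} + w {?a, ?c, ?d}"
      using flip_edge[OF assms(2) tri adj(1-5)] by blast
    have P: "{A, B, C, D} \<subseteq> P"
      using V fV(1) unfolding img by blast
    have "card (f ` {?a, ?b, ?c, ?d}) = 4"
      using T'(3) inj_on_subset[OF fV(2) V] by (simp only: card_image)
    then have card: "card {A, B, C, D} = 4"
      by (simp add: img)
    have "\<Phi> T\<^sub>0 \<le> \<Phi> T'"
      using T0 T'(1,2) by (simp add: X_def)
    moreover have "\<Phi> T' + W {A, B, D} + W {B, C, D} = \<Phi> T\<^sub>0 + W {A, B, C} + W {A, C, D}"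
      using T'(4)[of "\<lambda>Z. W (f ` Z)"] by (simp add: \<Phi>_def img del: image_image)
    ultimately have "\<not> bad A B C D"
      using decreasing[OF P card] by linarith
    then show ?thesis
      using P card by blast
  qed
  then show thesis
    using that[OF tri f0(1)] f0(2) by blast
qed

theorem proposition3p1:
  fixes S :: "'a topology" and T :: "(real^3 \<Rightarrow> 'a) set" and V :: "'a set"
    and P :: "(real^3) set" and f :: "'a \<Rightarrow> real^3"
  assumes "finite P"
    and "surface S"
    and "surface_triangulation S T V"
    and "realization S T V P f"
  shows "(\<exists>T\<^sub>0 f\<^sub>0. surface_triangulation S T\<^sub>0 V \<and> realization S T\<^sub>0 V P f\<^sub>0 \<and>
            (\<forall>v\<in>V. f\<^sub>0 v = f v) \<and> delaunay T\<^sub>0 f\<^sub>0) \<and>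
         ((\<forall>Q. Q \<subseteq> P \<and> card Q = 4 \<longrightarrow> \<not> coplanar Q) \<longrightarrow>
            (\<exists>T\<^sub>0 f\<^sub>0. surface_triangulation S T\<^sub>0 V \<and> realization S T\<^sub>0 V P f\<^sub>0 \<and>
               (\<forall>v\<in>V. f\<^sub>0 v = f v) \<and> strict_delaunay T\<^sub>0 f\<^sub>0))"
proof (intro conjI impI)
  have bij: "bij_betw f V P"
    using assms(4) by (simp add: realization_def)
  obtain \<epsilon> where \<epsilon>: "\<epsilon> > 0" "\<And>A B C D. {A, B, C, D} \<subseteq> P \<Longrightarrow> card {A, B, C, D} = 4 \<Longrightarrow>
      angle_at B A D + angle_at B C D > pi \<Longrightarrow> perturbed_cos \<epsilon> B A D + perturbed_cos \<epsilon> B C D < 0"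
    using uniform_perturbation[OF assms(1)] by blast
  obtain T\<^sub>0 f\<^sub>0 where "surface_triangulation S T\<^sub>0 V" "realization S T\<^sub>0 V P f\<^sub>0" "\<forall>v\<in>V. f\<^sub>0 v = f v"
    "\<And>A B C D. adjacent_images T\<^sub>0 f\<^sub>0 A B C D \<Longrightarrow>
      {A, B, C, D} \<subseteq> P \<and> card {A, B, C, D} = 4 \<and> \<not> angle_at B A D + angle_at B C D > pi"
    by (rule exists_triangulation_without_bad_edges[OF assms(1-3) bij,
        where bad = "\<lambda>A B C D. angle_at B A D + angle_at B C D > pi" and W = "perturbed_area \<epsilon>"])
      (simp_all add: perturbed_area_decreases[OF _ \<epsilon>(1) \<epsilon>(2)])
  then show "\<exists>T\<^sub>0 f\<^sub>0. surface_triangulation S T\<^sub>0 V \<and> realization S T\<^sub>0 V P f\<^sub>0 \<and>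
      (\<forall>v\<in>V. f\<^sub>0 v = f v) \<and> delaunay T\<^sub>0 f\<^sub>0"
    unfolding delaunay_def delaunay_condition_def not_less by blast
next
  have bij: "bij_betw f V P"
    using assms(4) by (simp add: realization_def)
  assume "\<forall>Q. Q \<subseteq> P \<and> card Q = 4 \<longrightarrow> \<not> coplanar Q"
  then have cop: "\<not> coplanar Q" if "Q \<subseteq> P" "card Q = 4" for Q
    using that by blast
  obtain T\<^sub>0 f\<^sub>0 where "surface_triangulation S T\<^sub>0 V" "realization S T\<^sub>0 V P f\<^sub>0" "\<forall>v\<in>V. f\<^sub>0 v = f v"
    "\<And>A B C D. adjacent_images T\<^sub>0 f\<^sub>0 A B C D \<Longrightarrow>
      {A, B, C, D} \<subseteq> P \<and> card {A, B, C, D} = 4 \<and> \<not> angle_at B A D + angle_at B C D \<ge> pi"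
    by (rule exists_triangulation_without_bad_edges[OF assms(1-3) bij,
        where bad = "\<lambda>A B C D. angle_at B A D + angle_at B C D \<ge> pi" and W = "perturbed_area 0"])
      (simp_all add: area_decreases_if_not_coplanar cop)
  then show "\<exists>T\<^sub>0 f\<^sub>0. surface_triangulation S T\<^sub>0 V \<and> realization S T\<^sub>0 V P f\<^sub>0 \<and>
      (\<forall>v\<in>V. f\<^sub>0 v = f v) \<and> strict_delaunay T\<^sub>0 f\<^sub>0"
    unfolding strict_delaunay_def strict_delaunay_condition_def not_le by blast
qed

end
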